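(* For the dyadic policy $\pi_D$, $$\frac{R(\pi_D,N)}{\sup_{\pi\in\Pi}R(\pi,N)}\ge\frac12 .$$
   Context: Setting. $\log$ is the logarithm to base 2. Let $k\ge 1$, $N\ge1$ be integers. $\theta=(\theta_1,\dots,\theta_k)$ is a random vector in $\mathbb R^k$ whose coordinates are i.i.d. with Lebesgue density $f_0$ on $\mathbb R$, so $\theta$ has density $p_0(u)=\prod_{i=1}^k f_0(u_i)$; the differential entropy $H_0=H(p_0)$ is assumed finite, where for a density $p$ on $\mathbb R^k$, $H(p)=-\int_{\mathbb R^k} p(u)\log p(u)\,du$. $Z$ is uniform on $[0,1]$ and independent of $\theta$. Policies. A policy is a sequence $\pi=(\pi_1,\dots,\pi_N)$ where $\pi_n$ is a Borel subset of $[0,1]\times\{0,1,\dots,k\}^{n-1}\times\mathbb R$; $\Pi$ is the set of all (adaptive) policies. Under $\pi$, the question sets and answers are defined recursively for $n=1,\dots,N$ by $A_n=\{t\in\mathbb R:(Z,X_1,\dots,X_{n-1},t)\in\pi_n\}$ and $X_n=\mathbb 1_{A_n}(\theta_1)+\dots+\mathbb 1_{A_n}(\theta_k)$. Posterior and rate. $p_n$ is the conditional (posterior) density of $\theta$ given the history $B_n=(Z,A_1,\dots,A_n,X_1,\dots,X_n)$: $p_n(u)$ is proportional to $p_0(u)$ on the set $\{u\in\mathbb R^k: X_m=\sum_{i=1}^k\mathbb 1_{A_m}(u_i),\ 1\le m\le n\}$ and is $0$ outside. The rate of reduction in expected entropy is $R(\pi,N)=\frac{H_0-E^\pi[H(p_N)]}{N}$.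 Dyadic policy. Let $F_0$ be the cumulative distribution function of $f_0$, $Q(p)=\inf\{u\in\mathbb R:p\le F_0(u)\}$ for $p\in[0,1]$ (possibly $\pm\infty$ at $p=0,1$), and $\mathrm{supp}(f_0)=\{u\in\mathbb R:f_0(u)>0\}$. The dyadic policy $\pi_D$ asks, deterministically, the questions $A_n=\left(\bigcup_{j=1}^{2^{n-1}}\left(Q\left(\frac{2j-1}{2^n}\right),Q\left(\frac{2j}{2^n}\right)\right]\right)\cap\mathrm{supp}(f_0)$, $n\ge1$. *)

theory Defs
  imports "HOL-Probability.Probability"
begin

text \<open>
  Vectors in \<open>\<real>\<^sup>k\<close> are functions on \<open>{1..k}\<close>, and \<open>\<Pi>\<^sub>M i\<in>{1..k}. lborel\<close> is Lebesgue measure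
  on \<open>\<real>\<^sup>k\<close>.
\<close>

abbreviation lborel_vec :: "nat \<Rightarrow> (nat \<Rightarrow> real) measure" where
  "lborel_vec k \<equiv> \<Pi>\<^sub>M i\<in>{1..k}. lborel"

text \<open>
  The library's \<open>indep_var\<close> requires both variables to take values in the same type; this is the
  same notion for arbitrary codomains.
\<close>

definition indep_rvs ::
    "'a measure \<Rightarrow> 'b measure \<Rightarrow> ('a \<Rightarrow> 'b) \<Rightarrow> 'c measure \<Rightarrow> ('a \<Rightarrow> 'c) \<Rightarrow> bool" where
  "indep_rvs M S X T Y \<longleftrightarrow>
     X \<in> measurable M S \<and> Y \<in> measurable M T \<and>
     prob_space.indep_set M {X -` A \<inter> space M | A. A \<in> sets S} {Y -` B \<inter> space M | B. B \<in> sets T}"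

definition prior_density :: "nat \<Rightarrow> (real \<Rightarrow> real) \<Rightarrow> (nat \<Rightarrow> real) \<Rightarrow> real" where
  "prior_density k f0 u = (\<Prod>i=1..k. f0 (u i))"

text \<open>The convention \<open>0 log 0 = 0\<close> holds automatically.\<close>

definition entropy_integrand :: "((nat \<Rightarrow> real) \<Rightarrow> real) \<Rightarrow> (nat \<Rightarrow> real) \<Rightarrow> real" where
  "entropy_integrand p u = p u * log 2 (p u)"

definition diff_entropy :: "nat \<Rightarrow> ((nat \<Rightarrow> real) \<Rightarrow> real) \<Rightarrow> real" where
  "diff_entropy k p = - (\<integral>u. entropy_integrand p u \<partial>lborel_vec k)"

definition finite_diff_entropy :: "nat \<Rightarrow> ((nat \<Rightarrow> real) \<Rightarrow> real) \<Rightarrow> bool" where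
  "finite_diff_entropy k p \<longleftrightarrow> integrable (lborel_vec k) (entropy_integrand p)"


text \<open>
  The \<open>n\<close>-th component of a policy is a set of triples \<open>(z, x, t)\<close>, where
  \<open>x \<in> {1..<n} \<rightarrow>\<^sub>E {0..k}\<close> is the tuple of the first \<open>n - 1\<close> answers. All factors are
  second countable, so the product \<open>\<sigma>\<close>-algebra below is the Borel \<open>\<sigma>\<close>-algebra of
  \<open>[0,1] \<times> {0,\<dots>,k}\<^bsup>n-1\<^esup> \<times> \<real>\<close>.
\<close>

type_synonym policy = "nat \<Rightarrow> (real \<times> (nat \<Rightarrow> nat) \<times> real) set"

definition policy_space :: "nat \<Rightarrow> nat \<Rightarrow> (real \<times> (nat \<Rightarrow> nat) \<times> real) measure" where
  "policy_space k n =
     restrict_space borel {0..1} \<Otimes>\<^sub>M (\<Pi>\<^sub>M m\<in>{1..<n}. count_space {0..k}) \<Otimes>\<^sub>M borel"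

text \<open>Only the components \<open>\<pi> 1, \<dots>, \<pi> N\<close> are constrained; the others are never used.\<close>

definition policies :: "nat \<Rightarrow> nat \<Rightarrow> policy set" where
  "policies k N = (\<Pi> n\<in>{1..N}. sets (policy_space k n))"

definition num_in :: "nat \<Rightarrow> real set \<Rightarrow> (nat \<Rightarrow> real) \<Rightarrow> nat" where
  "num_in k A u = (\<Sum>i=1..k. indicator A (u i))"

definition ask :: "policy \<Rightarrow> nat \<Rightarrow> real \<Rightarrow> (nat \<Rightarrow> nat) \<Rightarrow> real set" where
  "ask \<pi> n z x = {t. (z, x, t) \<in> \<pi> n}"

text \<open>
  \<open>answer k \<pi> z u n\<close> and \<open>question k \<pi> z u n\<close> are the values of \<open>X\<^sub>n\<close> and \<open>A\<^sub>n\<close> when \<open>Z = z\<close>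
  and \<open>\<theta> = u\<close>.
\<close>

lemma restrict_fundef_cong [fundef_cong]:
  "\<lbrakk>A = B; \<And>x. x \<in> B \<Longrightarrow> f x = g x\<rbrakk> \<Longrightarrow> restrict f A = restrict g B"
  by (auto simp: restrict_def)

fun answer :: "nat \<Rightarrow> policy \<Rightarrow> real \<Rightarrow> (nat \<Rightarrow> real) \<Rightarrow> nat \<Rightarrow> nat" where
  "answer k \<pi> z u n = num_in k (ask \<pi> n z (\<lambda>m\<in>{1..<n}. answer k \<pi> z u m)) u"

declare answer.simps [simp del]

definition question :: "nat \<Rightarrow> policy \<Rightarrow> real \<Rightarrow> (nat \<Rightarrow> real) \<Rightarrow> nat \<Rightarrow> real set" where
  "question k \<pi> z u n = ask \<pi> n z (\<lambda>m\<in>{1..<n}. answer k \<pi> z u m)"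


text \<open>
  \<open>consistent k A x n\<close> is the set of vectors that would give the answers \<open>x 1, \<dots>, x n\<close> to the
  questions \<open>A 1, \<dots>, A n\<close>.
\<close>

definition consistent :: "nat \<Rightarrow> (nat \<Rightarrow> real set) \<Rightarrow> (nat \<Rightarrow> nat) \<Rightarrow> nat \<Rightarrow> (nat \<Rightarrow> real) set" where
  "consistent k A x n = {u. \<forall>m\<in>{1..n}. x m = num_in k (A m) u}"

definition posterior_density ::
    "nat \<Rightarrow> (real \<Rightarrow> real) \<Rightarrow> (nat \<Rightarrow> real set) \<Rightarrow> (nat \<Rightarrow> nat) \<Rightarrow> nat \<Rightarrow> (nat \<Rightarrow> real) \<Rightarrow> real" where
  "posterior_density k f0 A x n u =
     (if u \<in> consistent k A x n
      then prior_density k f0 u /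
           (\<integral>v. indicator (consistent k A x n) v * prior_density k f0 v \<partial>lborel_vec k)
      else 0)"

definition posterior_entropy ::
    "nat \<Rightarrow> (real \<Rightarrow> real) \<Rightarrow> policy \<Rightarrow> nat \<Rightarrow> real \<Rightarrow> (nat \<Rightarrow> real) \<Rightarrow> real" where
  "posterior_entropy k f0 \<pi> n z u =
     diff_entropy k (posterior_density k f0 (question k \<pi> z u) (answer k \<pi> z u) n)"

definition rate ::
    "'a measure \<Rightarrow> nat \<Rightarrow> (real \<Rightarrow> real) \<Rightarrow> ('a \<Rightarrow> real) \<Rightarrow> (nat \<Rightarrow> 'a \<Rightarrow> real) \<Rightarrow> policy \<Rightarrow> nat \<Rightarrow> real" where
  "rate M k f0 Z \<theta> \<pi> N =
     (diff_entropy k (prior_density k f0)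
        - (\<integral>\<omega>. posterior_entropy k f0 \<pi> N (Z \<omega>) (\<lambda>i. \<theta> i \<omega>) \<partial>M)) / real N"


definition quantile :: "(real \<Rightarrow> real) \<Rightarrow> real \<Rightarrow> ereal" where
  "quantile f0 p = (INF u\<in>{u. p \<le> cdf (density lborel (\<lambda>t. ennreal (f0 t))) u}. ereal u)"

definition supp :: "(real \<Rightarrow> real) \<Rightarrow> real set" where
  "supp f0 = {u. f0 u > 0}"

definition dyadic_question :: "(real \<Rightarrow> real) \<Rightarrow> nat \<Rightarrow> real set" where
  "dyadic_question f0 n =
     (\<Union>j\<in>{1..2 ^ (n - 1)}.
        {t. quantile f0 ((2 * real j - 1) / 2 ^ n) < ereal t
            \<and> ereal t \<le> quantile f0 (2 * real j / 2 ^ n)}) \<inter> supp f0"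

definition dyadic_policy :: "nat \<Rightarrow> (real \<Rightarrow> real) \<Rightarrow> policy" where
  "dyadic_policy k f0 n = {0..1} \<times> ({1..<n} \<rightarrow>\<^sub>E {0..k}) \<times> dyadic_question f0 n"

lemma dyadic_policy_in_policies:
  assumes "f0 \<in> borel_measurable borel"
  shows "dyadic_policy k f0 \<in> policies k N"
proof -
  have "dyadic_question f0 n \<in> sets borel" for n
    using assms unfolding dyadic_question_def supp_def by measurable
  moreover have "({1..<n} \<rightarrow>\<^sub>E {0..k}) \<in> sets (\<Pi>\<^sub>M m\<in>{1..<n}. count_space {0..k})" for n :: nat
    by (rule sets_PiM_I_finite) auto
  moreover have "{0..1} \<in> sets (restrict_space borel {0..1::real})"
    by (simp add: sets_restrict_space_iff)
  ultimately show ?thesis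
    unfolding policies_def policy_space_def dyadic_policy_def
    by (intro Pi_I pair_measureI)
qed

end

(* Given Z = z the posterior is the prior conditioned on the answer vector X = (X_1, ..., X_N), so
   the expected entropy drops by exactly the discrete entropy of X. As X takes at most (k+1)^N
   values, this is at most N log (k+1). Under the dyadic policy the answers of the N questions at
   a single coordinate are the first N binary digits of F_0(theta_i), hence fair independent bits,
   and the probability of X = x is at most the product of the (k choose x_n) / 2^k. Entropy
   dominates minus the logarithm of the collision probability, and the collision probability of
   the binomial distribution is (2k choose k) / 4^k <= 1 / sqrt (k+1); so the drop is at least
   N log (k+1) / 2. *)

theory Submission
  imports Defs
begin

subsection \<open>Central binomial coefficients and discrete entropy\<close>

text \<open>Otherwise \<open>{1..k}\<close> is simplified to \<open>{Suc 0..k}\<close>, which the measurability rules do not recognise.\<close>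

declare One_nat_def [simp del]

text \<open>The factor 1/2 reflects the spread of a fair binomial count: it concentrates on the
  order of sqrt k of its k + 1 values, so its entropy is about half of log (k+1). The collision
  probability is convenient for three reasons: it is a central binomial coefficient in closed form,
  it multiplies over independent answers, and it increases with the point masses. An upper bound on
  the law of the answer tuple is therefore enough. The analytic care is due to integrals being 0 by
  default when they diverge. The expectation over Z is split off by Fubini, which takes joint
  measurability in (z, u) and a bound on the absolute posterior entropy that is uniform in z; both
  rest on there being finitely many answer tuples. Adaptivity is absorbed by one observation: for
  fixed z the earlier answers determine the next question, so the observed event is a fibre of a map
  on vectors.\<close>

lemma central_binomial_step: "Suc n * (2 * Suc n choose Suc n) = 2 * (2 * n + 1) * (2 * n choose n)"
proof -
  have "Suc n * (2 * Suc n choose Suc n) = (2 * Suc n) * (2 * n + 1 choose n)"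
    using Suc_times_binomial_eq[of "2 * n + 1" n] by simp
  moreover have "(2 * n + 1 choose n) = (2 * n + 1 choose Suc n)"
    using binomial_symmetric[of n "2 * n + 1"] by (simp add: One_nat_def)
  moreover have "Suc n * (2 * n + 1 choose Suc n) = (2 * n + 1) * (2 * n choose n)"
    using Suc_times_binomial_eq[of "2 * n" n] by (metis Suc_eq_plus1 mult.commute)
  ultimately have "Suc n * (Suc n * (2 * Suc n choose Suc n)) = Suc n * (2 * (2 * n + 1) * (2 * n choose n))"
    by (metis mult.assoc mult.left_commute)
  then show ?thesis by (simp only: mult_cancel1) simp
qed

text \<open>Squaring keeps the induction rational. The step from n to n + 1 multiplies the left side
  by ((2n+1)/(2n+2))^2 (n+2)/(n+1), which is at most 1 because (2n+1)^2 (n+2) <= 4 (n+1)^3.\<close>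

lemma central_binomial_upper_bound: "(real (2 * n choose n) / 4 ^ n)\<^sup>2 * (real n + 1) \<le> 1"
proof (induction n)
  case (Suc n)
  define c where "c = real (2 * n choose n) / 4 ^ n"
  have "real (Suc n) * real (2 * Suc n choose Suc n) = 2 * (2 * real n + 1) * real (2 * n choose n)"
    using arg_cong[OF central_binomial_step[of n], of real] by (simp only: of_nat_mult of_nat_add) simp
  then have "real (2 * Suc n choose Suc n) = 2 * (2 * real n + 1) * real (2 * n choose n) / (real n + 1)"
    by (simp add: field_simps del: binomial_Suc_Suc)
  moreover have "2 * (2 * r + 1) * b / (r + 1) / (4 * q) = b / q * ((2 * r + 1) / (2 * r + 2))"
    if "r \<ge> 0" "q > 0" for b q r :: real
    using that by (simp add: divide_simps) (simp add: algebra_simps)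
  ultimately have eq: "real (2 * Suc n choose Suc n) / 4 ^ Suc n = c * ((2 * real n + 1) / (2 * real n + 2))"
    unfolding c_def power_Suc by simp
  have "((2 * real n + 1) / (2 * real n + 2))\<^sup>2 * (real n + 2) \<le> real n + 1"
    by (simp add: power_divide divide_le_eq) (simp add: power2_eq_square algebra_simps)
  then have "c\<^sup>2 * (((2 * real n + 1) / (2 * real n + 2))\<^sup>2 * (real n + 2)) \<le> c\<^sup>2 * (real n + 1)"
    by (rule mult_left_mono) simp
  also have "\<dots> \<le> 1" using Suc by (simp add: c_def)
  finally have "(c * ((2 * real n + 1) / (2 * real n + 2)))\<^sup>2 * (real n + 2) \<le> 1"
    by (simp only: power_mult_distrib mult.assoc)
  moreover have "real (Suc n) + 1 = real n + 2" by simp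
  ultimately show ?case unfolding eq by (simp only:)
qed simp

lemma collision_binomial:
  "(\<Sum>j\<in>{0..k}. (real (k choose j) / 2 ^ k)\<^sup>2) = real (2 * k choose k) / 4 ^ k"
proof -
  have "(\<Sum>j\<in>{0..k}. (real (k choose j) / 2 ^ k)\<^sup>2) = real (\<Sum>j\<le>k. (k choose j)\<^sup>2) / 4 ^ k"
    by (simp add: power_divide sum_divide_distrib atLeast0AtMost power_mult[symmetric]
        power_even_eq[symmetric] mult.commute[of k 2] power_mult)
  then show ?thesis by (simp only: choose_square_sum)
qed

lemma neg_log_collision_binomial_ge:
  "- log 2 (real (2 * k choose k) / 4 ^ k) \<ge> log 2 (real k + 1) / 2"
proof -
  define c where "c = real (2 * k choose k) / 4 ^ k"
  have c: "c > 0" by (simp add: c_def)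
  have "log 2 (c\<^sup>2 * (real k + 1)) \<le> 0"
    using central_binomial_upper_bound[of k] c by (simp add: c_def[symmetric])
  then show ?thesis
    using c by (simp add: log_mult log_nat_power c_def[symmetric])
qed

section \<open>Entropy of finite distributions\<close>

text \<open>The right side is the tangent at p = 1/c to the concave function -p log p; the
  inequality is ln t <= t - 1 at t = 1/(c p). Being affine in p, the bound sums exactly over a
  distribution on c points, where the correction terms cancel.\<close>

lemma neg_mult_log_le:
  fixes p :: real
  assumes "0 \<le> p" "0 < c"
  shows "- (p * log 2 p) \<le> p * log 2 c + (1 / c - p) / ln 2"
proof (cases "p = 0")
  case False
  with assms have p: "p > 0" by simp
  have "ln (1 / (c * p)) \<le> 1 / (c * p) - 1" using p assms by (intro ln_le_minus_one) simp
  then have "p * (- ln p) \<le> p * (ln c + (1 / (c * p) - 1))"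
    using p assms by (intro mult_left_mono) (simp_all add: ln_div ln_mult)
  also have "\<dots> = p * ln c + (1 / c - p)"
    using p assms by (simp add: field_simps)
  finally show ?thesis
    by (simp add: log_def field_simps)
qed (use assms in simp)

text \<open>A crude bound, free of p, that serves to dominate the posterior entropy when
  integrability is proved.\<close>

lemma abs_mult_log_le:
  fixes p :: real
  assumes "0 \<le> p" "p \<le> 1"
  shows "\<bar>p * log 2 p\<bar> \<le> 1 / ln 2"
proof -
  have "p * log 2 p \<le> 0"
    using assms by (cases "p = 0") (auto simp: mult_le_0_iff)
  moreover have "- (p * log 2 p) \<le> (1 - p) / ln 2"
    using neg_mult_log_le[of p 1] assms by simp
  moreover have "(1 - p) / ln 2 \<le> 1 / ln 2" using assms by (intro divide_right_mono) auto
  ultimately show ?thesis by linarith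
qed

lemma entropy_le_log_card:
  fixes P :: "'b \<Rightarrow> real"
  assumes "finite S" "S \<noteq> {}" "\<And>x. x \<in> S \<Longrightarrow> 0 \<le> P x" "sum P S = 1"
  shows "- (\<Sum>x\<in>S. P x * log 2 (P x)) \<le> log 2 (real (card S))"
proof -
  define c where "c = real (card S)"
  have c: "c > 0" using assms by (simp add: c_def card_gt_0_iff)
  have "- (\<Sum>x\<in>S. P x * log 2 (P x)) \<le> (\<Sum>x\<in>S. P x * log 2 c + (1 / c - P x) / ln 2)"
    unfolding sum_negf[symmetric] using c assms by (intro sum_mono neg_mult_log_le) auto
  also have "\<dots> = sum P S * log 2 c + ((\<Sum>x\<in>S. 1 / c) - sum P S) / ln 2"
    by (simp add: sum.distrib sum_distrib_right sum_subtractf sum_divide_distrib[symmetric])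
  also have "\<dots> = log 2 c" using c assms by (simp add: c_def)
  finally show ?thesis by (simp add: c_def)
qed

text \<open>Jensen's inequality: the mean of -log P is at least -log of the mean of P, and the mean
  of P is the sum of the squares. The proof uses ln t <= t - 1 at t = P x / s. Since s is built from
  the majorant \<open>Q\<close>, the bound P <= Q enters through the sum of the squares of P being
  at most s, and \<open>Q\<close> may have any total mass.\<close>

lemma entropy_ge_collision:
  fixes P :: "'b \<Rightarrow> real"
  assumes "finite S" "\<And>x. x \<in> S \<Longrightarrow> 0 \<le> P x" "sum P S = 1"
    and "\<And>x. x \<in> S \<Longrightarrow> P x \<le> Q x"
  shows "- log 2 (\<Sum>x\<in>S. (Q x)\<^sup>2) \<le> - (\<Sum>x\<in>S. P x * log 2 (P x))"
proof -
  define s where "s = (\<Sum>x\<in>S. (Q x)\<^sup>2)"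
  obtain y where y: "y \<in> S" "P y > 0" using assms(1-3)
    by (metis less_eq_real_def sum.neutral zero_neq_one)
  have "s \<ge> (Q y)\<^sup>2" unfolding s_def using assms(1) y by (intro member_le_sum) auto
  moreover have "Q y > 0" using y assms(4)[of y] by linarith
  ultimately have s: "s > 0" by (meson less_le_trans zero_less_power)
  have "P x * log 2 (P x) \<le> P x * log 2 s + ((P x)\<^sup>2 / s - P x) / ln 2" if "x \<in> S" for x
  proof (cases "P x = 0")
    case False
    then have p: "P x > 0" using assms(2)[OF that] by simp
    have "ln (P x / s) \<le> P x / s - 1" using p s by (intro ln_le_minus_one) simp
    then have "P x * ln (P x) \<le> P x * (ln s + (P x / s - 1))"
      using p s by (intro mult_left_mono) (simp_all add: ln_div)
    then have "P x * ln (P x) \<le> P x * ln s + ((P x)\<^sup>2 / s - P x)"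
      by (simp add: power2_eq_square algebra_simps)
    then show ?thesis by (simp add: log_def field_simps)
  qed simp
  then have "(\<Sum>x\<in>S. P x * log 2 (P x)) \<le> (\<Sum>x\<in>S. P x * log 2 s + ((P x)\<^sup>2 / s - P x) / ln 2)"
    by (rule sum_mono)
  also have "\<dots> = sum P S * log 2 s + ((\<Sum>x\<in>S. (P x)\<^sup>2) / s - sum P S) / ln 2"
    by (simp add: sum.distrib sum_distrib_right sum_subtractf sum_divide_distrib[symmetric])
  also have "\<dots> \<le> log 2 s"
  proof -
    have "(\<Sum>x\<in>S. (P x)\<^sup>2) \<le> s"
      unfolding s_def by (intro sum_mono power_mono assms(2,4))
    then have "(\<Sum>x\<in>S. (P x)\<^sup>2) / s \<le> 1" using s by simp
    then show ?thesis by (simp add: assms(3) divide_nonpos_pos)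
  qed
  finally show ?thesis by (simp add: s_def)
qed

subsection \<open>Answers\<close>

lemma num_in_le: "num_in k A u \<le> k"
proof -
  have "num_in k A u \<le> (\<Sum>i=1..k. 1)"
    unfolding num_in_def by (intro sum_mono) (auto simp: indicator_def)
  then show ?thesis by simp
qed

lemma num_in_eq_card: "num_in k A u = card {i\<in>{1..k}. u i \<in> A}"
  unfolding num_in_def indicator_def by (simp add: sum.If_cases Int_def)

lemma answer_le: "answer k \<pi> z u n \<le> k"
  by (subst answer.simps) (rule num_in_le)

lemma answer_eq_num_in_question: "answer k \<pi> z u n = num_in k (question k \<pi> z u n) u"
  by (subst answer.simps) (simp add: question_def)

definition answers :: "nat \<Rightarrow> policy \<Rightarrow> nat \<Rightarrow> real \<Rightarrow> (nat \<Rightarrow> real) \<Rightarrow> nat \<Rightarrow> nat" where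
  "answers k \<pi> N z u = (\<lambda>m\<in>{1..N}. answer k \<pi> z u m)"

abbreviation tuples :: "nat \<Rightarrow> nat \<Rightarrow> (nat \<Rightarrow> nat) set" where
  "tuples k N \<equiv> {1..N} \<rightarrow>\<^sub>E {0..k}"

lemma answers_in_tuples: "answers k \<pi> N z u \<in> tuples k N"
  unfolding answers_def using answer_le by auto

lemma finite_tuples: "finite (tuples k N)"
  by (intro finite_PiE) auto

lemma card_tuples: "card (tuples k N) = (k + 1) ^ N"
  by (simp add: card_PiE One_nat_def)

text \<open>The left side fixes the questions put to u, the right side lets v meet its own
  questions. They agree because equal answers up to m - 1 produce the same m-th question, by
  induction on m. Conditioning on the history thus becomes conditioning on the value of
  \<open>answers k \<pi> N z\<close>.\<close>

lemma consistent_question_eq: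
  "consistent k (question k \<pi> z u) (answer k \<pi> z u) N = {v. answers k \<pi> N z v = answers k \<pi> N z u}"
proof -
  have "(\<forall>m\<in>{1..N}. answer k \<pi> z u m = num_in k (question k \<pi> z u m) v) \<longleftrightarrow>
        (\<forall>m\<in>{1..N}. answer k \<pi> z v m = answer k \<pi> z u m)" (is "?l \<longleftrightarrow> ?r") for v
  proof
    assume l: ?l
    have "m \<in> {1..N} \<Longrightarrow> answer k \<pi> z v m = answer k \<pi> z u m" for m
    proof (induction m rule: less_induct)
      case (less m)
      then have "(\<lambda>j\<in>{1..<m}. answer k \<pi> z v j) = (\<lambda>j\<in>{1..<m}. answer k \<pi> z u j)"
        by (intro restrict_ext) auto
      then have "question k \<pi> z v m = question k \<pi> z u m" by (simp add: question_def)
      then show ?case using l less.prems by (metis answer_eq_num_in_question)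
    qed
    then show ?r by blast
  next
    assume r: ?r
    have "question k \<pi> z v m = question k \<pi> z u m" if "m \<in> {1..N}" for m
      unfolding question_def using r that by (intro arg_cong[where f="ask \<pi> m z"] restrict_ext) auto
    then show ?l using r by (metis answer_eq_num_in_question)
  qed
  then show ?thesis
    by (auto simp: consistent_def answers_def fun_eq_iff restrict_def)
qed

text \<open>Policies are measurable over [0,1], while z ranges over all reals here. Hence z is
  clamped to [0,1] and the result multiplied by the indicator of [0,1]; for z outside, no triple
  lies in \<open>\<pi> n\<close> and the answer is 0 as well. The induction is needed because the
  question depends on the earlier answers.\<close>

lemma measurable_answer:
  assumes "\<pi> \<in> policies k N" "n \<in> {1..N}"
  shows "(\<lambda>p. answer k \<pi> (fst p) (snd p) n) \<in> measurable (borel \<Otimes>\<^sub>M lborel_vec k) (count_space UNIV)"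
  using assms(2)
proof (induction n rule: less_induct)
  case (less n)
  let ?K = "borel \<Otimes>\<^sub>M lborel_vec k"
  let ?h = "\<lambda>p. \<lambda>m\<in>{1..<n}. answer k \<pi> (fst p) (snd p) m"
  let ?c = "\<lambda>z::real. max 0 (min 1 z)"
  have h[measurable]: "?h \<in> measurable ?K (\<Pi>\<^sub>M m\<in>{1..<n}. count_space {0..k})"
  proof (rule measurable_restrict)
    fix m assume m: "m \<in> {1..<n}"
    then have "(\<lambda>p. answer k \<pi> (fst p) (snd p) m) \<in> measurable ?K (restrict_space (count_space UNIV) {0..k})"
      using less by (intro measurable_restrict_space2) (auto simp: answer_le)
    then show "(\<lambda>p. answer k \<pi> (fst p) (snd p) m) \<in> measurable ?K (count_space {0..k})"
      by (simp add: restrict_count_space)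
  qed
  have c[measurable]: "?c \<in> measurable borel (restrict_space borel {0..1})"
    by (intro measurable_restrict_space2) auto
  have [measurable]: "\<pi> n \<in> sets (policy_space k n)"
    using assms(1) less.prems by (auto simp: policies_def)
  have m: "(\<lambda>p. (?c (fst p), ?h p, snd p i)) \<in> measurable ?K (policy_space k n)" if [measurable]: "i \<in> {1..k}" for i
    unfolding policy_space_def by measurable
  have "(\<lambda>p. \<Sum>i=1..k. indicator {0..1} (fst p) * indicator (\<pi> n) (?c (fst p), ?h p, snd p i))
     \<in> measurable ?K (count_space (UNIV::nat set))" (is "?f \<in> _")
  proof -
    have [measurable]: "(\<lambda>p. indicator (\<pi> n) (?c (fst p), ?h p, snd p i) :: nat) \<in> measurable ?K (count_space UNIV)"
      if "i \<in> {1..k}" for i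
    proof (rule measurable_compose[OF m[OF that]])
      show "(indicator (\<pi> n) :: _ \<Rightarrow> nat) \<in> measurable (policy_space k n) (count_space UNIV)"
        unfolding indicator_def of_bool_def by measurable
    qed
    have [measurable]: "(\<lambda>z. indicator {0..1} z :: nat) \<in> measurable (borel :: real measure) (count_space UNIV)"
      unfolding indicator_def of_bool_def by measurable
    show ?thesis by measurable
  qed
  also have "?f = (\<lambda>p. answer k \<pi> (fst p) (snd p) n)"
  proof
    fix p :: "real \<times> (nat \<Rightarrow> real)"
    have sub: "\<pi> n \<subseteq> space (policy_space k n)" by (rule sets.sets_into_space) measurable
    have "indicator {0..1} (fst p) * indicator (\<pi> n) (?c (fst p), ?h p, t)
        = (indicator (ask \<pi> n (fst p) (?h p)) t :: nat)" for t
    proof (cases "fst p \<in> {0..1}")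
      case True
      then have "?c (fst p) = fst p" by auto
      with True show ?thesis by (simp add: ask_def indicator_def)
    next
      case False
      then have "(fst p, x) \<notin> \<pi> n" for x
        using sub by (auto simp: policy_space_def space_pair_measure space_restrict_space)
      with False show ?thesis by (simp add: ask_def indicator_def)
    qed
    then show "?f p = answer k \<pi> (fst p) (snd p) n"
      by (subst answer.simps) (simp add: num_in_def)
  qed
  finally show ?case .
qed

text \<open>The target has the discrete sigma-algebra on an uncountable type; the finite range
  \<open>tuples k N\<close> reduces the claim to the fibres of single tuples.\<close>

lemma measurable_answers:
  assumes "\<pi> \<in> policies k N"
  shows "(\<lambda>p. answers k \<pi> N (fst p) (snd p)) \<in> measurable (borel \<Otimes>\<^sub>M lborel_vec k) (count_space UNIV)"
proof -
  let ?K = "borel \<Otimes>\<^sub>M lborel_vec k :: (real \<times> (nat \<Rightarrow> real)) measure"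
  have "(\<lambda>p. answers k \<pi> N (fst p) (snd p)) \<in> measurable ?K (count_space (tuples k N))"
  proof (subst measurable_count_space_eq2[OF finite_tuples], intro conjI ballI)
    fix x assume x: "x \<in> tuples k N"
    have [measurable]: "(\<lambda>p. answer k \<pi> (fst p) (snd p) m) \<in> measurable ?K (count_space UNIV)" if "m \<in> {1..N}" for m
      using measurable_answer[OF assms that] .
    have "(\<lambda>p. answers k \<pi> N (fst p) (snd p)) -` {x} \<inter> space ?K =
        {p\<in>space ?K. \<forall>m\<in>{1..N}. answer k \<pi> (fst p) (snd p) m = x m}"
      using x by (auto simp: answers_def PiE_def extensional_def fun_eq_iff)
    also have "\<dots> \<in> sets ?K" by measurable
    finally show "(\<lambda>p. answers k \<pi> N (fst p) (snd p)) -` {x} \<inter> space ?K \<in> sets ?K" .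
  qed (use answers_in_tuples in auto)
  then have "(\<lambda>p. answers k \<pi> N (fst p) (snd p)) \<in> measurable ?K (restrict_space (count_space UNIV) (tuples k N))"
    by (simp add: restrict_count_space)
  then show ?thesis by (simp only: measurable_restrict_space2_iff)
qed

subsection \<open>Entropy of the prior conditioned on a discrete label\<close>

locale iid_prior =
  fixes k :: nat and f0 :: "real \<Rightarrow> real"
  assumes f0_measurable[measurable]: "f0 \<in> borel_measurable borel"
    and f0_nonneg: "f0 t \<ge> 0"
    and prob_space_f0: "prob_space (density lborel (\<lambda>t. ennreal (f0 t)))"
    and finite_entropy: "finite_diff_entropy k (prior_density k f0)"
begin

abbreviation "p0 \<equiv> prior_density k f0"
abbreviation "L \<equiv> lborel_vec k"

definition \<nu> :: "real measure" where
  "\<nu> = density lborel (\<lambda>t. ennreal (f0 t))"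

definition \<mu> :: "(nat \<Rightarrow> real) measure" where
  "\<mu> = density L (\<lambda>u. ennreal (p0 u))"

lemma sets_\<nu>[simp, measurable_cong]: "sets \<nu> = sets borel"
  by (simp add: \<nu>_def)

lemma space_\<nu>[simp]: "space \<nu> = UNIV"
  by (simp add: \<nu>_def)

lemma sets_\<mu>[simp, measurable_cong]: "sets \<mu> = sets L"
  by (simp add: \<mu>_def)

lemma space_\<mu>[simp]: "space \<mu> = space L"
  by (simp add: \<mu>_def)

sublocale \<nu>: prob_space \<nu>
  unfolding \<nu>_def by (rule prob_space_f0)

lemma p0_measurable[measurable]: "p0 \<in> borel_measurable L"
  unfolding prior_density_def[abs_def] by measurable

lemma p0_nonneg: "p0 u \<ge> 0"
  unfolding prior_density_def by (intro prod_nonneg f0_nonneg)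

text \<open>Entropy needs the density form of the prior, independence of the coordinates needs the
  product form. Boxes determine a product measure, and on a box both density and indicator factor
  over the coordinates.\<close>

lemma \<mu>_eq_PiM: "\<mu> = (\<Pi>\<^sub>M i\<in>{1..k}. \<nu>)"
proof -
  interpret L: product_sigma_finite "\<lambda>i::nat. lborel :: real measure"
    by (intro product_sigma_finite.intro) (rule lborel.sigma_finite_measure_axioms)
  interpret N: product_sigma_finite "\<lambda>i::nat. \<nu>"
    by (intro product_sigma_finite.intro) (rule \<nu>.sigma_finite_measure_axioms)
  show ?thesis
  proof (rule N.PiM_eqI)
    show "sets \<mu> = sets (\<Pi>\<^sub>M i\<in>{1..k}. \<nu>)"
      unfolding sets_\<mu> by (intro sets_PiM_cong) auto
  next
    fix A :: "nat \<Rightarrow> real set" assume "\<And>i. i \<in> {1..k} \<Longrightarrow> A i \<in> sets \<nu>"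
    then have A[measurable]: "\<And>i. i \<in> {1..k} \<Longrightarrow> A i \<in> sets borel" by simp
    have "Pi\<^sub>E {1..k} A \<in> sets L" by (intro sets_PiM_I_finite) (auto simp: A)
    then have "\<mu> (Pi\<^sub>E {1..k} A) = (\<integral>\<^sup>+u. ennreal (p0 u) * indicator (Pi\<^sub>E {1..k} A) u \<partial>L)"
      by (simp add: \<mu>_def emeasure_density)
    also have "\<dots> = (\<integral>\<^sup>+u. (\<Prod>i=1..k. ennreal (f0 (u i)) * indicator (A i) (u i)) \<partial>L)"
    proof (rule nn_integral_cong)
      fix u assume u: "u \<in> space L"
      have "(indicator (Pi\<^sub>E {1..k} A) u :: ennreal) = (\<Prod>i=1..k. indicator (A i) (u i))"
      proof (cases "u \<in> Pi\<^sub>E {1..k} A")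
        case True
        then have "(\<Prod>i=1..k. indicator (A i) (u i)) = (1::ennreal)" by (intro prod.neutral) (auto simp: PiE_iff)
        with True show ?thesis by simp
      next
        case False
        with u have "\<not> (\<forall>i\<in>{1..k}. u i \<in> A i)" by (auto simp: space_PiM PiE_iff)
        then obtain i where "i \<in> {1..k}" "u i \<notin> A i" by blast
        then have "(\<Prod>i=1..k. indicator (A i) (u i)) = (0::ennreal)"
          by (intro prod_zero) (auto intro!: bexI[of _ i])
        with False show ?thesis by simp
      qed
      then show "ennreal (p0 u) * indicator (Pi\<^sub>E {1..k} A) u =
          (\<Prod>i=1..k. ennreal (f0 (u i)) * indicator (A i) (u i))"
        by (simp add: prior_density_def prod.distrib prod_ennreal f0_nonneg)
    qed
    also have "\<dots> = (\<Prod>i=1..k. \<integral>\<^sup>+t. ennreal (f0 t) * indicator (A i) t \<partial>lborel)"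
      by (rule L.product_nn_integral_prod) auto
    also have "\<dots> = (\<Prod>i=1..k. \<nu> (A i))"
      by (intro prod.cong refl) (simp add: \<nu>_def emeasure_density)
    finally show "\<mu> (Pi\<^sub>E {1..k} A) = (\<Prod>i=1..k. \<nu> (A i))" .
  qed simp
qed

sublocale \<mu>: prob_space \<mu>
  unfolding \<mu>_eq_PiM by (intro prob_space_PiM \<nu>.prob_space_axioms)

lemma integral_\<mu>:
  fixes f :: "(nat \<Rightarrow> real) \<Rightarrow> real"
  assumes "f \<in> borel_measurable L"
  shows "(\<integral>u. f u \<partial>\<mu>) = (\<integral>u. p0 u * f u \<partial>L)"
  using assms unfolding \<mu>_def by (subst integral_density) (auto simp: p0_nonneg)

lemma integrable_p0: "integrable L p0"
proof -
  have "integrable \<mu> (\<lambda>_. 1::real)" by simp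
  then show ?thesis
    unfolding \<mu>_def by (subst (asm) integrable_density) (auto simp: p0_nonneg)
qed

definition mass :: "((nat \<Rightarrow> real) \<Rightarrow> 'b) \<Rightarrow> 'b \<Rightarrow> real" where
  "mass X x = measure \<mu> {v\<in>space L. X v = x}"

text \<open>The junk value \<open>y / 0 = 0\<close> makes this the zero function when \<open>x\<close> has probability zero.\<close>

definition conditional_density :: "((nat \<Rightarrow> real) \<Rightarrow> 'b) \<Rightarrow> 'b \<Rightarrow> (nat \<Rightarrow> real) \<Rightarrow> real" where
  "conditional_density X x v = (if X v = x then p0 v / mass X x else 0)"

context
  fixes X :: "(nat \<Rightarrow> real) \<Rightarrow> 'b"
  assumes X[measurable]: "X \<in> measurable L (count_space UNIV)"
begin

lemma mass_nonneg: "mass X x \<ge> 0" and mass_le_1: "mass X x \<le> 1"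
  by (simp_all add: mass_def)

lemma mass_eq_integral: "mass X x = (\<integral>v. indicator {v. X v = x} v * p0 v \<partial>L)"
proof -
  have "mass X x = (\<integral>v. indicator {v\<in>space L. X v = x} v \<partial>\<mu>)"
    by (simp add: mass_def)
  also have "\<dots> = (\<integral>v. p0 v * indicator {v\<in>space L. X v = x} v \<partial>L)"
    by (rule integral_\<mu>) measurable
  also have "\<dots> = (\<integral>v. indicator {v. X v = x} v * p0 v \<partial>L)"
    by (intro Bochner_Integration.integral_cong) (auto simp: indicator_def)
  finally show ?thesis .
qed

lemma integrable_slice:
  "integrable L (\<lambda>v. indicator {v. X v = x} v * entropy_integrand p0 v)"
proof -
  have "integrable L (\<lambda>v. indicator {v\<in>space L. X v = x} v *\<^sub>R entropy_integrand p0 v)"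
    using finite_entropy unfolding finite_diff_entropy_def
    by (intro integrable_mult_indicator) measurable
  also have "?this \<longleftrightarrow> ?thesis"
    by (intro Bochner_Integration.integrable_cong) (auto simp: indicator_def)
  finally show ?thesis .
qed

lemma integrable_slice_p0: "integrable L (\<lambda>v. indicator {v. X v = x} v * p0 v)"
proof -
  have "integrable L (\<lambda>v. indicator {v\<in>space L. X v = x} v *\<^sub>R p0 v)"
    using integrable_p0 by (intro integrable_mult_indicator) measurable
  also have "?this \<longleftrightarrow> ?thesis"
    by (intro Bochner_Integration.integrable_cong) (auto simp: indicator_def)
  finally show ?thesis .
qed

text \<open>On the fibre of x, log (p0 / mass) = log p0 - log mass. The factor
  \<open>mass X x\<close> is the weight of x in the expectation, and with it the identity covers
  labels of probability zero too.\<close>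

lemma mass_times_entropy:
  "mass X x * diff_entropy k (conditional_density X x) =
    mass X x * log 2 (mass X x) - (\<integral>v. indicator {v. X v = x} v * entropy_integrand p0 v \<partial>L)"
proof (cases "mass X x = 0")
  case True
  \<comment> \<open>A null label has \<open>p0\<close> = 0 almost everywhere on its fibre, so the
    entropy slice vanishes there by 0 log 0 = 0.\<close>
  have "AE v in L. indicator {v. X v = x} v * p0 v = 0"
    using True integrable_slice_p0[of x] unfolding mass_eq_integral
    by (subst (asm) integral_nonneg_eq_0_iff_AE) (auto simp: p0_nonneg)
  then have "AE v in L. indicator {v. X v = x} v * entropy_integrand p0 v = 0"
    by eventually_elim (auto simp: entropy_integrand_def)
  then have "(\<integral>v. indicator {v. X v = x} v * entropy_integrand p0 v \<partial>L) = 0"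
    by (rule integral_eq_zero_AE)
  with True show ?thesis by simp
next
  case False
  then have P: "mass X x > 0" using mass_nonneg[of x] by linarith
  have "mass X x * entropy_integrand (conditional_density X x) v =
      indicator {v. X v = x} v * entropy_integrand p0 v
      - log 2 (mass X x) * (indicator {v. X v = x} v * p0 v)" for v
    using P p0_nonneg[of v]
    by (cases "p0 v = 0")
      (auto simp: entropy_integrand_def conditional_density_def indicator_def log_divide algebra_simps)
  then have "mass X x * (\<integral>v. entropy_integrand (conditional_density X x) v \<partial>L) =
      (\<integral>v. indicator {v. X v = x} v * entropy_integrand p0 v
      - log 2 (mass X x) * (indicator {v. X v = x} v * p0 v) \<partial>L)"
    by (simp add: integral_mult_right_zero[symmetric])
  also have "\<dots> = (\<integral>v. indicator {v. X v = x} v * entropy_integrand p0 v \<partial>L) - log 2 (mass X x) * mass X x"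
    using integrable_slice integrable_slice_p0 by (simp add: mass_eq_integral)
  finally show ?thesis by (simp add: diff_entropy_def algebra_simps)
qed

context
  fixes S :: "'b set"
  assumes S: "finite S" "\<And>v. X v \<in> S"
begin

lemma sum_indicator_slices: "(\<Sum>x\<in>S. indicator {v. X v = x} u * (f x :: real)) = f (X u)"
proof -
  have "(\<Sum>x\<in>S. indicator {v. X v = x} u * f x) = (\<Sum>x\<in>S. if x = X u then f x else 0)"
    by (intro sum.cong) (auto simp: indicator_def)
  then show ?thesis using S by simp
qed

lemma has_integral_function_of_label:
  fixes f :: "'b \<Rightarrow> real"
  shows "integrable \<mu> (\<lambda>u. f (X u))" "(\<integral>u. f (X u) \<partial>\<mu>) = (\<Sum>x\<in>S. mass X x * f x)"
proof -
  let ?g = "\<lambda>u. \<Sum>x\<in>S. indicator {v\<in>space L. X v = x} u * f x"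
  have eq: "f (X u) = ?g u" if "u \<in> space \<mu>" for u
    unfolding sum_indicator_slices[symmetric] using that
    by (intro sum.cong) (auto simp: indicator_def)
  have m: "{v\<in>space L. X v = x} \<in> sets \<mu>" for x by measurable
  have i: "integrable \<mu> (\<lambda>u. indicator {v\<in>space L. X v = x} u * f x)" for x
    using m[of x] by (intro integrable_mult_left integrable_real_indicator) (auto simp: less_top[symmetric])
  show "integrable \<mu> (\<lambda>u. f (X u))"
    using i by (subst Bochner_Integration.integrable_cong[OF refl eq]) auto
  have "(\<integral>u. f (X u) \<partial>\<mu>) = (\<integral>u. ?g u \<partial>\<mu>)"
    by (rule Bochner_Integration.integral_cong[OF refl eq])
  also have "\<dots> = (\<Sum>x\<in>S. \<integral>u. indicator {v\<in>space L. X v = x} u * f x \<partial>\<mu>)"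
    by (rule Bochner_Integration.integral_sum) (rule i)
  also have "\<dots> = (\<Sum>x\<in>S. mass X x * f x)"
    by (simp add: mass_def)
  finally show "(\<integral>u. f (X u) \<partial>\<mu>) = (\<Sum>x\<in>S. mass X x * f x)" .
qed

lemma sum_mass: "(\<Sum>x\<in>S. mass X x) = 1"
  using has_integral_function_of_label(2)[of "\<lambda>_. 1"] \<mu>.prob_space by simp

lemma sum_slices:
  fixes g :: "(nat \<Rightarrow> real) \<Rightarrow> real"
  assumes "integrable L g"
    and "\<And>x. integrable L (\<lambda>v. indicator {v. X v = x} v * g v)"
  shows "(\<Sum>x\<in>S. \<integral>v. indicator {v. X v = x} v * g v \<partial>L) = (\<integral>v. g v \<partial>L)"
proof -
  have "(\<Sum>x\<in>S. \<integral>v. indicator {v. X v = x} v * g v \<partial>L) =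
      (\<integral>v. (\<Sum>x\<in>S. indicator {v. X v = x} v * g v) \<partial>L)"
    by (rule Bochner_Integration.integral_sum[symmetric]) (rule assms)
  also have "\<dots> = (\<integral>v. g v \<partial>L)"
  proof (rule Bochner_Integration.integral_cong[OF refl])
    show "(\<Sum>x\<in>S. indicator {v. X v = x} v * g v) = g v" for v
      using sum_indicator_slices[of v "\<lambda>_. g v"] .
  qed
  finally show ?thesis .
qed

text \<open>The chain rule for a label that is a function of the vector: the slices of the entropy
  integrand add up to the prior entropy, and what remains is minus the discrete entropy of the
  label.\<close>

lemma expected_conditional_entropy:
  "(\<integral>u. diff_entropy k (conditional_density X (X u)) \<partial>\<mu>) =
    diff_entropy k p0 + (\<Sum>x\<in>S. mass X x * log 2 (mass X x))"
  unfolding has_integral_function_of_label(2)[of "\<lambda>x. diff_entropy k (conditional_density X x)"]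
    mass_times_entropy sum_subtractf
  using sum_slices[of "entropy_integrand p0"] finite_entropy integrable_slice
  by (simp add: diff_entropy_def finite_diff_entropy_def)

text \<open>The bound depends on the label map only through the size of its range, so it is uniform
  in z when the label is the answer tuple. This is what Fubini requires.\<close>

lemma expected_abs_conditional_entropy_le:
  "(\<integral>u. \<bar>diff_entropy k (conditional_density X (X u))\<bar> \<partial>\<mu>) \<le>
    real (card S) / ln 2 + (\<integral>v. \<bar>entropy_integrand p0 v\<bar> \<partial>L)"
proof -
  have ai: "integrable L (\<lambda>v. indicator {v. X v = x} v * \<bar>entropy_integrand p0 v\<bar>)" for x
    using integrable_abs[OF integrable_slice[of x]] by (simp add: abs_mult)
  have "(\<integral>u. \<bar>diff_entropy k (conditional_density X (X u))\<bar> \<partial>\<mu>) =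
      (\<Sum>x\<in>S. \<bar>mass X x * diff_entropy k (conditional_density X x)\<bar>)"
    unfolding has_integral_function_of_label(2)[of "\<lambda>x. \<bar>diff_entropy k (conditional_density X x)\<bar>"]
    by (simp add: abs_mult mass_nonneg)
  also have "\<dots> \<le> (\<Sum>x\<in>S. 1 / ln 2 + (\<integral>v. indicator {v. X v = x} v * \<bar>entropy_integrand p0 v\<bar> \<partial>L))"
  proof (rule sum_mono)
    fix x assume "x \<in> S"
    have "\<bar>\<integral>v. indicator {v. X v = x} v * entropy_integrand p0 v \<partial>L\<bar> \<le>
        (\<integral>v. indicator {v. X v = x} v * \<bar>entropy_integrand p0 v\<bar> \<partial>L)"
      using integral_abs_bound[of L "\<lambda>v. indicator {v. X v = x} v * entropy_integrand p0 v"]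
      by (simp add: abs_mult)
    moreover have "\<bar>mass X x * log 2 (mass X x)\<bar> \<le> 1 / ln 2"
      by (intro abs_mult_log_le mass_nonneg mass_le_1)
    ultimately show "\<bar>mass X x * diff_entropy k (conditional_density X x)\<bar> \<le>
        1 / ln 2 + (\<integral>v. indicator {v. X v = x} v * \<bar>entropy_integrand p0 v\<bar> \<partial>L)"
      unfolding mass_times_entropy by linarith
  qed
  also have "\<dots> = real (card S) / ln 2 + (\<integral>v. \<bar>entropy_integrand p0 v\<bar> \<partial>L)"
    using sum_slices[of "\<lambda>v. \<bar>entropy_integrand p0 v\<bar>"] finite_entropy ai
    by (simp add: sum.distrib finite_diff_entropy_def)
  finally show ?thesis .
qed

end

end

subsection \<open>The dyadic questions\<close>

sublocale \<nu>: real_distribution \<nu>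
  by standard simp_all

lemma isCont_cdf_\<nu>: "isCont (cdf \<nu>) t"
proof -
  have "{t} \<in> null_sets lborel" by (simp add: null_sets_def)
  moreover have "absolutely_continuous lborel \<nu>"
    unfolding \<nu>_def by (intro absolutely_continuousI_density) measurable
  ultimately have "{t} \<in> null_sets \<nu>" by (auto simp: absolutely_continuous_def)
  then show ?thesis unfolding \<nu>.isCont_cdf by (simp add: measure_def null_sets_def)
qed

abbreviation "Q \<equiv> quantile f0"

lemma quantile_eq: "Q p = (INF u\<in>{u. p \<le> cdf \<nu> u}. ereal u)"
  by (simp add: quantile_def \<nu>_def)

lemma quantile_mono: "p \<le> p' \<Longrightarrow> Q p \<le> Q p'"
  unfolding quantile_eq by (intro INF_superset_mono) auto

lemma le_cdf_imp_quantile_le: "p \<le> cdf \<nu> u \<Longrightarrow> Q p \<le> ereal u"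
  unfolding quantile_eq by (intro INF_lower) simp

lemma quantile_less_imp_le_cdf:
  assumes "Q p < ereal u"
  shows "p \<le> cdf \<nu> u"
proof -
  obtain u' where "p \<le> cdf \<nu> u'" "u' < u"
    using assms unfolding quantile_eq INF_less_iff by auto
  then show ?thesis using \<nu>.cdf_nondecreasing[of u' u] by linarith
qed

text \<open>For finite q = \<open>Q p\<close>, the cdf is at least p to the right of q and at most p
  to the left, and continuity forces equality at q. An infinite quantile arises only at p = 1 (plus
  infinity) or p = 0 (minus infinity), by the limits of the cdf at both ends.\<close>

lemma measure_le_quantile:
  assumes "0 \<le> p" "p \<le> 1"
  shows "measure \<nu> {t. ereal t \<le> Q p} = p"
proof (cases "Q p")
  case (real q)
  have lim: "(cdf \<nu> \<longlongrightarrow> cdf \<nu> q) (at q)"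
    using isCont_cdf_\<nu>[of q] by (simp add: isCont_def)
  have "p \<le> cdf \<nu> q"
  proof (rule tendsto_lowerbound)
    show "(cdf \<nu> \<longlongrightarrow> cdf \<nu> q) (at_right q)" using lim by (rule filterlim_mono) (auto intro: at_le)
    show "\<forall>\<^sub>F u in at_right q. p \<le> cdf \<nu> u"
      using eventually_at_right_less[of q] by eventually_elim (auto intro: quantile_less_imp_le_cdf simp: real)
  qed simp
  moreover have "cdf \<nu> q \<le> p"
  proof (rule tendsto_upperbound)
    show "(cdf \<nu> \<longlongrightarrow> cdf \<nu> q) (at_left q)" using lim by (rule filterlim_mono) (auto intro: at_le)
    have "cdf \<nu> u \<le> p" if "u < q" for u
      using le_cdf_imp_quantile_le[of p u] that real by (cases "p \<le> cdf \<nu> u") auto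
    then show "\<forall>\<^sub>F u in at_left q. cdf \<nu> u \<le> p"
      by (auto simp: eventually_at_filter intro: always_eventually)
  qed simp
  ultimately show ?thesis by (simp add: real cdf_def2 atMost_def)
next
  case PInf
  have "cdf \<nu> u \<le> p" for u
    using le_cdf_imp_quantile_le[of p u] PInf by (cases "p \<le> cdf \<nu> u") auto
  then have "1 \<le> p"
    by (intro tendsto_upperbound[OF \<nu>.cdf_lim_at_top_prob]) (auto intro: always_eventually)
  then show ?thesis using PInf assms \<nu>.prob_space by simp
next
  case MInf
  have "p \<le> cdf \<nu> u" for u
    by (rule quantile_less_imp_le_cdf) (simp add: MInf)
  then have "p \<le> 0"
    by (intro tendsto_lowerbound[OF \<nu>.cdf_lim_at_bot]) (auto intro: always_eventually)
  then show ?thesis using MInf assms by simp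
qed

section \<open>Dyadic cells and the binary digits of their indices\<close>

text \<open>Indices start at 0, so that the binary digits of j are the answers on
  \<open>cell n j\<close>. The l-th interval of a dyadic question is then the cell of odd index 2l -
  1.\<close>

definition cell :: "nat \<Rightarrow> nat \<Rightarrow> real set" where
  "cell n j = {t. Q (real j / 2 ^ n) < ereal t \<and> ereal t \<le> Q ((real j + 1) / 2 ^ n)}"

lemma sets_cell[measurable]: "cell n j \<in> sets borel"
  unfolding cell_def by measurable

lemma measure_cell:
  assumes "j < 2 ^ n"
  shows "measure \<nu> (cell n j) = 1 / 2 ^ n"
proof -
  have j: "real j + 1 \<le> 2 ^ n"
    using assms by (metis Suc_eq_plus1 Suc_leI of_nat_1 of_nat_add of_nat_le_iff of_nat_numeral of_nat_power)
  then have j': "real j \<le> 2 ^ n" by linarith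
  have "cell n j = {t. ereal t \<le> Q ((real j + 1) / 2 ^ n)} - {t. ereal t \<le> Q (real j / 2 ^ n)}"
    by (auto simp: cell_def)
  also have "measure \<nu> \<dots> = (real j + 1) / 2 ^ n - real j / 2 ^ n"
  proof (subst \<nu>.finite_measure_Diff)
    have "Q (real j / 2 ^ n) \<le> Q ((real j + 1) / 2 ^ n)"
      by (intro quantile_mono divide_right_mono) auto
    then show "{t. ereal t \<le> Q (real j / 2 ^ n)} \<subseteq> {t. ereal t \<le> Q ((real j + 1) / 2 ^ n)}"
      by (auto intro: order_trans)
  qed (use j j' in \<open>simp_all add: measure_le_quantile\<close>)
  finally show ?thesis by (simp add: diff_divide_distrib[symmetric])
qed

lemma cell_unique:
  assumes "t \<in> cell n i" "t \<in> cell n j"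
  shows "i = j"
proof -
  have False if "i < j" "t \<in> cell n i" "t \<in> cell n j" for i j
  proof -
    have "real i + 1 \<le> real j" using that(1) by linarith
    then have "Q ((real i + 1) / 2 ^ n) \<le> Q (real j / 2 ^ n)"
      by (intro quantile_mono divide_right_mono) auto
    then show False using that(2,3) by (auto simp: cell_def)
  qed
  then show ?thesis using assms by (meson linorder_neqE_nat)
qed

text \<open>Going from level n to level m drops the last d = n - m binary digits of the index. With
  i the quotient, i 2^d <= j and j + 1 <= (i + 1) 2^d, so the grid intervals are nested, and
  monotone quantiles carry this over to cells.\<close>

lemma cell_coarsen:
  assumes "t \<in> cell n j" "m \<le> n"
  shows "t \<in> cell m (j div 2 ^ (n - m))"
proof -
  define d where "d = n - m"
  define i where "i = j div 2 ^ d"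
  have n: "(2::real) ^ n = 2 ^ m * 2 ^ d" using assms(2) by (simp add: d_def power_add[symmetric])
  have "i * 2 ^ d \<le> j" by (simp add: i_def)
  then have "real (i * 2 ^ d) \<le> real j" by (simp only: of_nat_le_iff)
  then have 1: "real i * 2 ^ d \<le> real j" by simp
  have "j < (i + 1) * 2 ^ d"
  proof -
    have "j < 2 ^ d + 2 ^ d * i" unfolding i_def by (rule dividend_less_times_div) simp
    also have "\<dots> = (i + 1) * 2 ^ d" by (simp add: algebra_simps)
    finally show ?thesis .
  qed
  then have "real (j + 1) \<le> real ((i + 1) * 2 ^ d)" by (simp only: of_nat_le_iff)
  then have 2: "real j + 1 \<le> (real i + 1) * 2 ^ d" by (simp add: add.commute)
  have rescale: "r / 2 ^ m = r * 2 ^ d / 2 ^ n" for r :: real unfolding n by simp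
  have "real i / 2 ^ m \<le> real j / 2 ^ n" "(real j + 1) / 2 ^ n \<le> (real i + 1) / 2 ^ m"
    unfolding rescale using 1 2 by (auto intro!: divide_right_mono)
  then have "Q (real i / 2 ^ m) \<le> Q (real j / 2 ^ n)" "Q ((real j + 1) / 2 ^ n) \<le> Q ((real i + 1) / 2 ^ m)"
    by (auto intro: quantile_mono)
  then show ?thesis
    using assms(1) unfolding cell_def i_def[symmetric] d_def[symmetric] by auto
qed

lemma AE_in_cell: "AE t in \<nu>. \<exists>j<2 ^ n. t \<in> cell n j"
proof -
  have "AE t in \<nu>. t \<in> {t. ereal t \<le> Q 1}"
    by (subst \<nu>.prob_eq_1[symmetric]) (simp_all add: measure_le_quantile)
  moreover have "AE t in \<nu>. t \<notin> {t. ereal t \<le> Q 0}"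
    by (subst \<nu>.prob_eq_0[symmetric]) (simp_all add: measure_le_quantile)
  ultimately show ?thesis
  proof eventually_elim
    case (elim t)
    let ?P = "\<lambda>i. ereal t \<le> Q (real i / 2 ^ n)"
    \<comment> \<open>Since t > \<open>Q 0\<close>, the least grid index whose quantile reaches t is
      positive; its predecessor is the index of the cell.\<close>
    define i where "i = (LEAST i. ?P i)"
    have P: "?P (2 ^ n)" using elim by simp
    have Pi: "?P i" unfolding i_def by (rule LeastI[of ?P, OF P])
    have i_le: "i \<le> 2 ^ n" unfolding i_def by (rule Least_le[of ?P, OF P])
    have "i \<noteq> 0" using Pi elim(2) by (auto simp: not_le intro: ccontr)
    then obtain j where j: "i = Suc j" using not0_implies_Suc by blast
    have "\<not> ?P j" using not_less_Least[of j ?P] by (simp add: i_def[symmetric] j)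
    then have "t \<in> cell n j" using Pi by (simp add: cell_def j add.commute)
    then show ?case using i_le j by (auto simp: Suc_le_eq)
  qed
qed

text \<open>This disposes of the intersection with \<open>supp f0\<close> in the dyadic
  questions.\<close>

lemma AE_f0_pos: "AE t in \<nu>. f0 t > 0"
  unfolding \<nu>_def by (subst AE_density) auto

text \<open>Question m collects the odd cells of level m, and the cell of level m around t has index
  j div 2^(n - m). Its parity is the m-th of the n digits of j, counted from the most significant
  one.\<close>

lemma in_dyadic_question_iff:
  assumes t: "t \<in> cell n j" "f0 t > 0" and j: "j < 2 ^ n" and m: "m \<in> {1..n}"
  shows "t \<in> dyadic_question f0 m \<longleftrightarrow> odd (j div 2 ^ (n - m))"
proof -
  define i where "i = j div 2 ^ (n - m)"
  have i: "t \<in> cell m i" unfolding i_def using t(1) m by (intro cell_coarsen) auto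
  have "i < 2 ^ m" unfolding i_def using j m
    by (simp add: less_mult_imp_div_less power_add[symmetric])
  have "t \<in> dyadic_question f0 m \<longleftrightarrow> (\<exists>l\<in>{1..2 ^ (m - 1)}. t \<in> cell m (2 * l - 1))"
    using t(2) by (auto simp: dyadic_question_def supp_def cell_def of_nat_diff)
  also have "\<dots> \<longleftrightarrow> odd i"
  proof
    assume "\<exists>l\<in>{1..2 ^ (m - 1)}. t \<in> cell m (2 * l - 1)"
    then obtain l where l: "l \<ge> 1" "t \<in> cell m (2 * l - 1)" by auto
    then have "i = 2 * l - 1" using i cell_unique by blast
    then show "odd i" using l by simp
  next
    assume "odd i"
    then obtain l where l: "i = 2 * l + 1" by (rule oddE)
    have "(2::nat) ^ m = 2 * 2 ^ (m - 1)" using m by (cases m) auto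
    then have "l + 1 \<in> {1..2 ^ (m - 1)}" using \<open>i < 2 ^ m\<close> l by simp
    moreover have "2 * (l + 1) - 1 = i" using l by simp
    then have "t \<in> cell m (2 * (l + 1) - 1)" using i by (simp only:)
    ultimately show "\<exists>l\<in>{1..2 ^ (m - 1)}. t \<in> cell m (2 * l - 1)" by blast
  qed
  finally show ?thesis by (simp add: i_def)
qed

text \<open>The word of n yes/no answers at the single point t, stored as the set of positions
  answered yes. Words thus range over \<open>Pow {1..n}\<close>, which suits the counting
  below.\<close>

definition pattern :: "nat \<Rightarrow> real \<Rightarrow> nat set" where
  "pattern n t = {m\<in>{1..n}. t \<in> dyadic_question f0 m}"

lemma sets_dyadic_question[measurable]: "dyadic_question f0 m \<in> sets borel"
  unfolding dyadic_question_def supp_def by measurable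

lemma sets_pattern[measurable]: "{t. pattern n t = B} \<in> sets borel"
proof -
  have "{t. pattern n t = B} = {t\<in>space borel. B \<subseteq> {1..n} \<and> (\<forall>m\<in>{1..n}. t \<in> dyadic_question f0 m \<longleftrightarrow> m \<in> B)}"
    unfolding pattern_def by auto
  also have "\<dots> \<in> sets borel" by measurable
  finally show ?thesis .
qed

text \<open>The questions reveal the first \<open>n\<close> binary digits of \<open>F\<^sub>0(t)\<close>, which is uniform on \<open>[0,1]\<close>.\<close>

lemma measure_pattern_le: "measure \<nu> {t. pattern n t = B} \<le> 1 / 2 ^ n"
proof -
  define digits where "digits j = {m\<in>{1..n}. odd (j div 2 ^ (n - m))}" for j :: nat
  define J where "J = {j. j < 2 ^ n \<and> digits j = B}"
  \<comment> \<open>Bit l of j is the digit asked for by question n - l, so a number below 2^n is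
    determined by its digit set, and at most one cell of level n has pattern
    \<open>B\<close>.\<close>
  have inj: "i = j" if ij: "i < 2 ^ n" "j < 2 ^ n" "digits i = digits j" for i j
  proof (rule bit_eqI)
    fix l
    show "bit i l \<longleftrightarrow> bit j l"
    proof (cases "l < n")
      case True
      then have "n - l \<in> {1..n}" "n - (n - l) = l" by auto
      then show ?thesis using ij(3) unfolding digits_def bit_iff_odd set_eq_iff
        by (metis (mono_tags, lifting) mem_Collect_eq)
    next
      case False
      then have "(2::nat) ^ n \<le> 2 ^ l" by (intro power_increasing) auto
      then have "i < 2 ^ l" "j < 2 ^ l" using ij(1,2) by linarith+
      then show ?thesis by (simp add: bit_iff_odd)
    qed
  qed
  have "AE t in \<nu>. t \<in> {t. pattern n t = B} \<longrightarrow> t \<in> (\<Union>j\<in>J. cell n j)"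
    using AE_in_cell[of n] AE_f0_pos
  proof eventually_elim
    case (elim t)
    then obtain j where j: "j < 2 ^ n" "t \<in> cell n j" by blast
    have "pattern n t = digits j"
      unfolding pattern_def digits_def using in_dyadic_question_iff[OF j(2) elim(2) j(1)] by auto
    then show ?case using j by (auto simp: J_def)
  qed
  moreover have "finite J" by (rule finite_subset[of _ "{..<2 ^ n}"]) (auto simp: J_def)
  ultimately have "measure \<nu> {t. pattern n t = B} \<le> measure \<nu> (\<Union>j\<in>J. cell n j)"
    by (intro \<nu>.finite_measure_mono_AE) auto
  also have "\<dots> \<le> 1 / 2 ^ n"
  proof (cases "J = {}")
    case False
    then obtain j where j: "j \<in> J" by blast
    then have "J = {j}" using inj by (auto simp: J_def)
    moreover have "j < 2 ^ n" using j by (simp add: J_def)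
    ultimately show ?thesis by (simp add: measure_cell)
  qed simp
  finally show ?thesis .
qed

lemma answers_dyadic:
  assumes "z \<in> {0..1}"
  shows "answers k (dyadic_policy k f0) N z u = (\<lambda>m\<in>{1..N}. num_in k (dyadic_question f0 m) u)"
proof -
  have "answer k (dyadic_policy k f0) z u m = num_in k (dyadic_question f0 m) u" for m
  proof -
    have "(\<lambda>j\<in>{1..<m}. answer k (dyadic_policy k f0) z u j) \<in> {1..<m} \<rightarrow>\<^sub>E {0..k}"
      using answer_le by auto
    then have "ask (dyadic_policy k f0) m z (\<lambda>j\<in>{1..<m}. answer k (dyadic_policy k f0) z u j) = dyadic_question f0 m"
      using assms by (simp add: ask_def dyadic_policy_def)
    then show ?thesis by (subst answer.simps) simp
  qed
  then show ?thesis by (simp add: answers_def)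
qed

section \<open>Counting patterns and bounding the law of the dyadic answers\<close>

text \<open>A family c is a 0/1 matrix with k columns and N rows, given by its columns. Transposing
  is injective and turns it into rows, where row m is an x m-element subset of
  \<open>{1..k}\<close>; rows can be counted separately.\<close>

lemma card_columns_le:
  fixes N :: nat
  shows
  "card {c \<in> {1..k} \<rightarrow>\<^sub>E Pow {1..N}. \<forall>m\<in>{1..N}. card {i\<in>{1..k}. m \<in> c i} = x m}
    \<le> (\<Prod>m\<in>{1..N}. k choose x m)" (is "card ?C \<le> _")
proof -
  let ?D = "\<Pi>\<^sub>E m\<in>{1..N}. {I. I \<subseteq> {1..k} \<and> card I = x m}"
  let ?f = "\<lambda>c. \<lambda>m\<in>{1..N}. {i\<in>{1..k}. m \<in> c i}"
  have "inj_on ?f ?C"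
  proof (rule inj_onI)
    fix c d assume c: "c \<in> ?C" and d: "d \<in> ?C" and eq: "?f c = ?f d"
    have "m \<in> c i \<longleftrightarrow> m \<in> d i" if "i \<in> {1..k}" for i m
    proof (cases "m \<in> {1..N}")
      case True
      then have "{i\<in>{1..k}. m \<in> c i} = {i\<in>{1..k}. m \<in> d i}" using fun_cong[OF eq, of m] by simp
      with that show ?thesis by blast
    next
      case False
      moreover have "c i \<subseteq> {1..N}" "d i \<subseteq> {1..N}" using c d that by (auto simp: PiE_iff)
      ultimately show ?thesis by blast
    qed
    then have "c i = d i" if "i \<in> {1..k}" for i using that by blast
    with c d show "c = d" by (intro PiE_ext[of c "{1..k}" "\<lambda>_. Pow {1..N}" d]) auto
  qed
  moreover have "?f ` ?C \<subseteq> ?D" by auto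
  moreover have "finite ?D" by (intro finite_PiE) auto
  ultimately have "card ?C \<le> card ?D" by (rule card_inj_on_le)
  also have "\<dots> = (\<Prod>m\<in>{1..N}. k choose x m)"
    by (simp add: card_PiE n_subsets)
  finally show ?thesis .
qed

text \<open>The event is covered by boxes, one for each admissible choice of a pattern at every
  coordinate. By independence of the coordinates a box has measure at most 2^(-N k), the column
  count bounds the number of boxes, and 2^(-N k) is shared out as 2^(-k) to each of the N
  questions.\<close>

lemma mass_dyadic_le:
  assumes z: "z \<in> {0..1}"
  shows "mass (answers k (dyadic_policy k f0) N z) x \<le> (\<Prod>m\<in>{1..N}. real (k choose x m) / 2 ^ k)"
proof -
  interpret P: product_sigma_finite "\<lambda>i::nat. \<nu>"
    by (intro product_sigma_finite.intro) (rule \<nu>.sigma_finite_measure_axioms)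
  define C where "C = {c \<in> {1..k} \<rightarrow>\<^sub>E Pow {1..N}. \<forall>m\<in>{1..N}. card {i\<in>{1..k}. m \<in> c i} = x m}"
  define box where "box c = (\<Pi>\<^sub>E i\<in>{1..k}. {t. pattern N t = c i})" for c
  have box_sets: "box c \<in> sets \<mu>" for c
    unfolding box_def \<mu>_eq_PiM by (intro sets_PiM_I_finite) auto
  have box_le: "measure \<mu> (box c) \<le> (1 / 2 ^ N) ^ k" for c
  proof -
    have "emeasure \<mu> (box c) = (\<Prod>i\<in>{1..k}. emeasure \<nu> {t. pattern N t = c i})"
      unfolding box_def \<mu>_eq_PiM by (intro P.emeasure_PiM) auto
    then have "measure \<mu> (box c) = (\<Prod>i\<in>{1..k}. measure \<nu> {t. pattern N t = c i})"
      by (simp add: \<mu>.emeasure_eq_measure \<nu>.emeasure_eq_measure prod_ennreal prod_nonneg)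
    also have "\<dots> \<le> (\<Prod>i\<in>{1..k}. 1 / 2 ^ N)"
      by (intro prod_mono) (auto intro: measure_pattern_le)
    finally show ?thesis by simp
  qed
  have finC: "finite C" unfolding C_def by (intro finite_subset[OF _ finite_PiE[of "{1..k}" "\<lambda>_. Pow {1..N}"]]) auto
  have "{v\<in>space L. answers k (dyadic_policy k f0) N z v = x} \<subseteq> (\<Union>c\<in>C. box c)"
  proof safe
    fix v assume v: "v \<in> space L" and x: "x = answers k (dyadic_policy k f0) N z v"
    let ?c = "\<lambda>i\<in>{1..k}. pattern N (v i)"
    have "card {i\<in>{1..k}. m \<in> ?c i} = x m" if "m \<in> {1..N}" for m
    proof -
      have "{i\<in>{1..k}. m \<in> ?c i} = {i\<in>{1..k}. v i \<in> dyadic_question f0 m}"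
        using that by (auto simp: pattern_def)
      with that show ?thesis by (simp add: x answers_dyadic[OF z] num_in_eq_card)
    qed
    then have "?c \<in> C" by (auto simp: C_def pattern_def)
    moreover have "v \<in> box ?c" using v by (auto simp: box_def space_PiM PiE_iff)
    ultimately show "v \<in> (\<Union>c\<in>C. box c)"
      unfolding x by blast
  qed
  moreover have "(\<Union>c\<in>C. box c) \<in> sets \<mu>"
    by (intro sets.finite_UN finC box_sets)
  ultimately have "mass (answers k (dyadic_policy k f0) N z) x \<le> measure \<mu> (\<Union>c\<in>C. box c)"
    unfolding mass_def by (intro \<mu>.finite_measure_mono)
  also have "\<dots> \<le> (\<Sum>c\<in>C. measure \<mu> (box c))"
    by (intro \<mu>.finite_measure_subadditive_finite finC image_subsetI box_sets)
  also have "\<dots> \<le> real (card C) * (1 / 2 ^ N) ^ k"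
    using sum_bounded_above[of C "\<lambda>c. measure \<mu> (box c)"] box_le by simp
  also have "\<dots> \<le> real (\<Prod>m\<in>{1..N}. k choose x m) * (1 / 2 ^ N) ^ k"
    unfolding C_def by (intro mult_right_mono of_nat_mono card_columns_le) auto
  also have "\<dots> = (\<Prod>m\<in>{1..N}. real (k choose x m) / 2 ^ k)"
    by (simp add: prod_dividef power_divide power_mult[symmetric] mult.commute)
  finally show ?thesis .
qed

lemma sum_squares_product_tuples:
  fixes q :: "nat \<Rightarrow> real"
  shows "(\<Sum>x\<in>tuples k N. (\<Prod>m\<in>{1..N}. q (x m))\<^sup>2) = (\<Sum>j\<in>{0..k}. (q j)\<^sup>2) ^ N"
proof -
  have "(\<Sum>x\<in>tuples k N. (\<Prod>m\<in>{1..N}. q (x m))\<^sup>2) = (\<Sum>x\<in>tuples k N. \<Prod>m\<in>{1..N}. (q (x m))\<^sup>2)"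
    by (simp add: prod_power_distrib)
  also have "\<dots> = (\<Prod>m\<in>{1..N}. \<Sum>j\<in>{0..k}. (q j)\<^sup>2)"
    by (subst prod_sum_PiE) simp_all
  finally show ?thesis by simp
qed

subsection \<open>Expected posterior entropy\<close>

lemma posterior_density_eq:
  assumes "answers k \<pi> N z \<in> measurable L (count_space UNIV)"
  shows "posterior_density k f0 (question k \<pi> z u) (answer k \<pi> z u) N =
    conditional_density (answers k \<pi> N z) (answers k \<pi> N z u)"
  unfolding posterior_density_def conditional_density_def mass_eq_integral[OF assms]
    consistent_question_eq by (rule ext) simp

definition answer_entropy :: "policy \<Rightarrow> nat \<Rightarrow> real \<Rightarrow> real" where
  "answer_entropy \<pi> N z = - (\<Sum>x\<in>tuples k N.
     mass (answers k \<pi> N z) x * log 2 (mass (answers k \<pi> N z) x))"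

context
  fixes \<pi> :: policy and N :: nat
  assumes policy: "\<pi> \<in> policies k N"
begin

lemma measurable_answers_fixed: "answers k \<pi> N z \<in> measurable L (count_space UNIV)"
proof -
  have "(\<lambda>u. (z, u)) \<in> measurable L (borel \<Otimes>\<^sub>M L)" by measurable
  from measurable_compose[OF this measurable_answers[OF policy]] show ?thesis by simp
qed

lemma expected_posterior_entropy_fixed:
  "(\<integral>u. posterior_entropy k f0 \<pi> N z u \<partial>\<mu>) = diff_entropy k p0 - answer_entropy \<pi> N z"
  "integrable \<mu> (posterior_entropy k f0 \<pi> N z)"
  "(\<integral>u. \<bar>posterior_entropy k f0 \<pi> N z u\<bar> \<partial>\<mu>) \<le>
    real (card (tuples k N)) / ln 2 + (\<integral>v. \<bar>entropy_integrand p0 v\<bar> \<partial>L)"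
proof -
  have eq: "posterior_entropy k f0 \<pi> N z =
      (\<lambda>u. diff_entropy k (conditional_density (answers k \<pi> N z) (answers k \<pi> N z u)))"
    unfolding posterior_entropy_def posterior_density_eq[OF measurable_answers_fixed] ..
  note facts = measurable_answers_fixed finite_tuples answers_in_tuples
  show "(\<integral>u. posterior_entropy k f0 \<pi> N z u \<partial>\<mu>) = diff_entropy k p0 - answer_entropy \<pi> N z"
    unfolding eq answer_entropy_def by (subst expected_conditional_entropy[OF facts]) simp
  show "integrable \<mu> (posterior_entropy k f0 \<pi> N z)"
    unfolding eq
    by (rule has_integral_function_of_label(1)[OF facts, where f="\<lambda>x. diff_entropy k (conditional_density (answers k \<pi> N z) x)"])
  show "(\<integral>u. \<bar>posterior_entropy k f0 \<pi> N z u\<bar> \<partial>\<mu>) \<le>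
    real (card (tuples k N)) / ln 2 + (\<integral>v. \<bar>entropy_integrand p0 v\<bar> \<partial>L)"
    unfolding eq by (rule expected_abs_conditional_entropy_le[OF facts])
qed

lemma answer_entropy_le: "answer_entropy \<pi> N z \<le> real N * log 2 (real k + 1)"
proof -
  have "answer_entropy \<pi> N z \<le> log 2 (real (card (tuples k N)))"
    unfolding answer_entropy_def
  proof (rule entropy_le_log_card[OF finite_tuples])
    show "tuples k N \<noteq> {}" by (simp add: PiE_eq_empty_iff)
    show "sum (mass (answers k \<pi> N z)) (tuples k N) = 1"
      by (rule sum_mass[OF measurable_answers_fixed finite_tuples answers_in_tuples])
  qed (rule mass_nonneg[OF measurable_answers_fixed])
  also have "\<dots> = real N * log 2 (real k + 1)"
    by (simp add: card_tuples log_nat_power add.commute)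
  finally show ?thesis .
qed

text \<open>Both the normalising mass and the entropy are integrals over a further vector v with
  parameter p = (z, u). It suffices that the integrands are jointly measurable in q = ((z, u),
  v).\<close>

lemma measurable_posterior_entropy:
  "(\<lambda>p. posterior_entropy k f0 \<pi> N (fst p) (snd p)) \<in> borel_measurable (borel \<Otimes>\<^sub>M L)"
proof -
  let ?a = "answers k \<pi> N"
  have [measurable]: "(\<lambda>p. ?a (fst p) (snd p)) \<in> measurable (borel \<Otimes>\<^sub>M L) (count_space UNIV)"
    by (rule measurable_answers[OF policy])
  have a3[measurable]: "(\<lambda>q. ?a (fst (fst q)) (snd q)) \<in> measurable ((borel \<Otimes>\<^sub>M L) \<Otimes>\<^sub>M L) (count_space UNIV)"
  proof -
    have "(\<lambda>q. (fst (fst q), snd q)) \<in> measurable ((borel \<Otimes>\<^sub>M L) \<Otimes>\<^sub>M L) (borel \<Otimes>\<^sub>M L)" by measurable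
    from measurable_compose[OF this measurable_answers[OF policy]] show ?thesis by simp
  qed
  have a2[measurable]: "(\<lambda>q. ?a (fst (fst q)) (snd (fst q))) \<in> measurable ((borel \<Otimes>\<^sub>M L) \<Otimes>\<^sub>M L) (count_space UNIV)"
    by measurable
  have eqset[measurable]: "Measurable.pred ((borel \<Otimes>\<^sub>M L) \<Otimes>\<^sub>M L) (\<lambda>q. ?a (fst (fst q)) (snd q) = ?a (fst (fst q)) (snd (fst q)))"
  proof -
    \<comment> \<open>Equality of the labels of v and u is a finite union over the common value, so
      that only comparisons with constants remain.\<close>
    have "(?a (fst (fst q)) (snd q) = ?a (fst (fst q)) (snd (fst q))) \<longleftrightarrow>
      (\<exists>x\<in>tuples k N. ?a (fst (fst q)) (snd q) = x \<and> ?a (fst (fst q)) (snd (fst q)) = x)" for q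
      using answers_in_tuples by metis
    moreover have "Measurable.pred ((borel \<Otimes>\<^sub>M L) \<Otimes>\<^sub>M L) (\<lambda>q. ?a (fst (fst q)) (snd q) = x)"
      "Measurable.pred ((borel \<Otimes>\<^sub>M L) \<Otimes>\<^sub>M L) (\<lambda>q. ?a (fst (fst q)) (snd (fst q)) = x)" for x
      by (rule pred_eq_const1[OF a3], simp) (rule pred_eq_const1[OF a2], simp)
    ultimately show ?thesis
      by (simp only:) (intro pred_intros_finite pred_intros_logic finite_tuples)
  qed
  have L: "sigma_finite_measure L"
    by (intro product_sigma_finite.sigma_finite product_sigma_finite.intro lborel.sigma_finite_measure_axioms) simp
  have "(\<lambda>q. if ?a (fst (fst q)) (snd q) = ?a (fst (fst q)) (snd (fst q)) then p0 (snd q) else 0)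
      \<in> borel_measurable ((borel \<Otimes>\<^sub>M L) \<Otimes>\<^sub>M L)" (is "?g \<in> _")
    by measurable
  then have "(\<lambda>p. \<integral>v. ?g (p, v) \<partial>L) \<in> borel_measurable (borel \<Otimes>\<^sub>M L)"
    by (intro sigma_finite_measure.borel_measurable_lebesgue_integral[OF L]) (simp add: split_beta')
  then have [measurable]: "(\<lambda>p. mass (?a (fst p)) (?a (fst p) (snd p))) \<in> borel_measurable (borel \<Otimes>\<^sub>M L)"
    unfolding mass_eq_integral[OF measurable_answers_fixed]
    by (rule measurable_cong[THEN iffD1, rotated]) (auto intro!: Bochner_Integration.integral_cong simp: indicator_def)
  have "(\<lambda>q. entropy_integrand (conditional_density (?a (fst (fst q))) (?a (fst (fst q)) (snd (fst q)))) (snd q))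
      \<in> borel_measurable ((borel \<Otimes>\<^sub>M L) \<Otimes>\<^sub>M L)"
    unfolding entropy_integrand_def conditional_density_def by measurable
  then have "(\<lambda>p. diff_entropy k (conditional_density (?a (fst p)) (?a (fst p) (snd p))))
      \<in> borel_measurable (borel \<Otimes>\<^sub>M L)"
    unfolding diff_entropy_def
    by (intro borel_measurable_uminus sigma_finite_measure.borel_measurable_lebesgue_integral[OF L]) (simp add: split_beta')
  then show ?thesis
    by (simp add: posterior_entropy_def posterior_density_eq[OF measurable_answers_fixed])
qed

end

lemma answer_entropy_dyadic_ge:
  assumes z: "z \<in> {0..1}"
  shows "answer_entropy (dyadic_policy k f0) N z \<ge> real N * (log 2 (real k + 1) / 2)"
proof -
  let ?m = "mass (answers k (dyadic_policy k f0) N z)"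
  let ?q = "\<lambda>j. real (k choose j) / 2 ^ k"
  note meas = measurable_answers_fixed[OF dyadic_policy_in_policies[OF f0_measurable]]
  have "real N * (log 2 (real k + 1) / 2) \<le> real N * (- log 2 (real (2 * k choose k) / 4 ^ k))"
    by (intro mult_left_mono neg_log_collision_binomial_ge) simp
  \<comment> \<open>The collision sum of a product law is the N-th power of the single one, which
    supplies the factor N.\<close>
  also have "\<dots> = - log 2 (\<Sum>x\<in>tuples k N. (\<Prod>m\<in>{1..N}. ?q (x m))\<^sup>2)"
    unfolding sum_squares_product_tuples[where q="?q"] collision_binomial by (simp add: log_nat_power)
  also have "\<dots> \<le> answer_entropy (dyadic_policy k f0) N z"
    unfolding answer_entropy_def
    by (rule entropy_ge_collision[OF finite_tuples])
      (auto intro: mass_nonneg[OF meas] mass_dyadic_le[OF z]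
        sum_mass[OF meas finite_tuples answers_in_tuples])
  finally show ?thesis .
qed

section \<open>Averaging over the law of Z\<close>

context
  fixes \<pi> :: policy and N :: nat and \<zeta> :: "real measure"
  assumes policy: "\<pi> \<in> policies k N"
    and prob_space_\<zeta>: "prob_space \<zeta>" and sets_\<zeta>[measurable_cong]: "sets \<zeta> = sets borel"
begin

text \<open>Fubini, with integrability on the product space obtained by bounding the inner integral
  of the absolute value by a constant free of z.\<close>

lemma integrable_expected_posterior_entropy:
  "integrable \<zeta> (\<lambda>z. diff_entropy k p0 - answer_entropy \<pi> N z)"
  and expected_posterior_entropy:
  "(\<integral>p. posterior_entropy k f0 \<pi> N (fst p) (snd p) \<partial>(\<zeta> \<Otimes>\<^sub>M \<mu>)) =
    (\<integral>z. diff_entropy k p0 - answer_entropy \<pi> N z \<partial>\<zeta>)"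
proof -
  interpret Z: prob_space \<zeta> by fact
  interpret P: pair_prob_space \<zeta> \<mu> ..
  have m[measurable]: "(\<lambda>p. posterior_entropy k f0 \<pi> N (fst p) (snd p)) \<in> borel_measurable (\<zeta> \<Otimes>\<^sub>M \<mu>)"
    using measurable_posterior_entropy[OF policy]
    by (simp add: measurable_cong_sets[OF sets_pair_measure_cong[OF sets_\<zeta> sets_\<mu>] refl])
  have int: "integrable (\<zeta> \<Otimes>\<^sub>M \<mu>) (\<lambda>p. posterior_entropy k f0 \<pi> N (fst p) (snd p))"
  proof (rule P.Fubini_integrable[OF m])
    have [measurable]: "(\<lambda>p. norm (posterior_entropy k f0 \<pi> N (fst p) (snd p))) \<in> borel_measurable (\<zeta> \<Otimes>\<^sub>M \<mu>)"
      by measurable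
    have "(\<lambda>z. \<integral>u. norm (posterior_entropy k f0 \<pi> N (fst (z, u)) (snd (z, u))) \<partial>\<mu>) \<in> borel_measurable \<zeta>"
      by measurable
    then show "integrable \<zeta> (\<lambda>z. \<integral>u. norm (posterior_entropy k f0 \<pi> N (fst (z, u)) (snd (z, u))) \<partial>\<mu>)"
      using expected_posterior_entropy_fixed(3)[OF policy]
      by (intro Z.integrable_const_bound) auto
    show "AE z in \<zeta>. integrable \<mu> (\<lambda>u. posterior_entropy k f0 \<pi> N (fst (z, u)) (snd (z, u)))"
      using expected_posterior_entropy_fixed(2)[OF policy] by simp
  qed
  show "integrable \<zeta> (\<lambda>z. diff_entropy k p0 - answer_entropy \<pi> N z)"
    using P.integrable_fst'[OF int] by (simp add: expected_posterior_entropy_fixed(1)[OF policy])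
  show "(\<integral>p. posterior_entropy k f0 \<pi> N (fst p) (snd p) \<partial>(\<zeta> \<Otimes>\<^sub>M \<mu>)) =
    (\<integral>z. diff_entropy k p0 - answer_entropy \<pi> N z \<partial>\<zeta>)"
    using P.integral_fst'[OF int] by (simp add: expected_posterior_entropy_fixed(1)[OF policy])
qed

text \<open>Bounds for each z pass to the mean because \<open>\<zeta>\<close> has total mass 1. The
  lower bound asks for almost every z, since the dyadic estimate is stated for z in [0,1].\<close>

lemma entropy_reduction_bounds:
  defines "E \<equiv> (\<integral>p. posterior_entropy k f0 \<pi> N (fst p) (snd p) \<partial>(\<zeta> \<Otimes>\<^sub>M \<mu>))"
  shows "diff_entropy k p0 - E \<le> real N * log 2 (real k + 1)"
    and "(AE z in \<zeta>. c \<le> answer_entropy \<pi> N z) \<Longrightarrow> c \<le> diff_entropy k p0 - E"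
proof -
  interpret Z: prob_space \<zeta> by fact
  have "diff_entropy k p0 - real N * log 2 (real k + 1) \<le> E"
    unfolding E_def expected_posterior_entropy
    by (rule Z.integral_ge_const[OF integrable_expected_posterior_entropy])
      (use answer_entropy_le[OF policy] in auto)
  then show "diff_entropy k p0 - E \<le> real N * log 2 (real k + 1)" by linarith
  assume "AE z in \<zeta>. c \<le> answer_entropy \<pi> N z"
  then have "E \<le> diff_entropy k p0 - c"
    unfolding E_def expected_posterior_entropy
    by (intro Z.integral_le_const[OF integrable_expected_posterior_entropy]) auto
  then show "c \<le> diff_entropy k p0 - E" by linarith
qed

end

end

section \<open>From the random variables to their joint law\<close>

text \<open>Independence is the product rule on measurable rectangles, and these determine the
  product measure. Here Z and the vector take values in different types.\<close>

lemma (in prob_space) distr_pair_indep_rvs: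
  assumes "indep_rvs M S X T Y"
  shows "distr M (S \<Otimes>\<^sub>M T) (\<lambda>\<omega>. (X \<omega>, Y \<omega>)) = distr M S X \<Otimes>\<^sub>M distr M T Y"
proof -
  have X[measurable]: "X \<in> measurable M S" and Y[measurable]: "Y \<in> measurable M T"
    and ind: "indep_set {X -` A \<inter> space M | A. A \<in> sets S} {Y -` B \<inter> space M | B. B \<in> sets T}"
    using assms by (auto simp: indep_rvs_def)
  show ?thesis
  proof (rule pair_measure_eqI[symmetric])
    show "sigma_finite_measure (distr M S X)" "sigma_finite_measure (distr M T Y)"
      by (auto intro!: prob_space_imp_sigma_finite prob_space_distr)
    fix A B assume "A \<in> sets (distr M S X)" "B \<in> sets (distr M T Y)"
    then have [measurable]: "A \<in> sets S" "B \<in> sets T" by auto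
    have "prob ((X -` A \<inter> space M) \<inter> (Y -` B \<inter> space M)) = prob (X -` A \<inter> space M) * prob (Y -` B \<inter> space M)"
      by (rule indep_setD[OF ind]) auto
    moreover have "(\<lambda>\<omega>. (X \<omega>, Y \<omega>)) -` (A \<times> B) \<inter> space M = (X -` A \<inter> space M) \<inter> (Y -` B \<inter> space M)" by auto
    ultimately show "emeasure (distr M S X) A * emeasure (distr M T Y) B =
        emeasure (distr M (S \<Otimes>\<^sub>M T) (\<lambda>\<omega>. (X \<omega>, Y \<omega>))) (A \<times> B)"
      by (simp add: emeasure_distr emeasure_eq_measure ennreal_mult)
  qed simp
qed

theorem corollary1:
  fixes M :: "'a measure" and k N :: nat and f0 :: "real \<Rightarrow> real"
    and Z :: "'a \<Rightarrow> real" and \<theta> :: "nat \<Rightarrow> 'a \<Rightarrow> real"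
  assumes "prob_space M"
    and "k \<ge> 1" and "N \<ge> 1"
    and "f0 \<in> borel_measurable borel" and "\<And>t. f0 t \<ge> 0"
    and "\<And>i. i \<in> {1..k} \<Longrightarrow> distributed M lborel (\<theta> i) (\<lambda>t. ennreal (f0 t))"
    and "prob_space.indep_vars M (\<lambda>_. borel) \<theta> {1..k}"
    and "distributed M lborel Z (indicator {0..1})"
    and "indep_rvs M borel Z (\<Pi>\<^sub>M i\<in>{1..k}. borel) (\<lambda>\<omega>. \<lambda>i\<in>{1..k}. \<theta> i \<omega>)"
    and "finite_diff_entropy k (prior_density k f0)"
  shows "ereal (rate M k f0 Z \<theta> (dyadic_policy k f0) N)
           / (SUP \<pi>\<in>policies k N. ereal (rate M k f0 Z \<theta> \<pi> N)) \<ge> 1 / 2"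
proof -
  interpret prob_space M by fact
  have \<theta>_meas[measurable]: "\<theta> i \<in> borel_measurable M" if "i \<in> {1..k}" for i
    using assms(6)[OF that] by (simp add: distributed_def)
  have Z_meas[measurable]: "Z \<in> borel_measurable M"
    using assms(8) by (simp add: distributed_def)
  have distr_\<theta>: "distr M borel (\<theta> i) = density lborel (\<lambda>t. ennreal (f0 t))" if "i \<in> {1..k}" for i
    using assms(6)[OF that] by (simp add: distributed_def cong: distr_cong)
  have "1 \<in> {1..k}" using assms(2) by simp
  then have "prob_space (density lborel (\<lambda>t. ennreal (f0 t)))"
    using prob_space_distr[OF \<theta>_meas] distr_\<theta> by metis
  then interpret iid_prior k f0
    using assms(4,5,10) by (intro iid_prior.intro)
  define \<zeta> where "\<zeta> = distr M borel Z"
  define R where "R = (\<lambda>\<pi>. rate M k f0 Z \<theta> \<pi> N)"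
  have \<zeta>: "prob_space \<zeta>" "sets \<zeta> = sets borel"
    by (simp_all add: \<zeta>_def prob_space_distr)
  have AE_\<zeta>: "AE z in \<zeta>. z \<in> {0..1}"
  proof -
    have "\<zeta> = density lborel (indicator {0..1})"
      using assms(8) by (simp add: \<zeta>_def distributed_def cong: distr_cong)
    moreover have "AE z in density lborel (indicator {0..1}). z \<in> {0..1::real}"
      by (subst AE_density) (auto simp: indicator_def)
    ultimately show ?thesis by (simp only:)
  qed
  have "distr M (\<Pi>\<^sub>M i\<in>{1..k}. borel) (\<lambda>\<omega>. \<lambda>i\<in>{1..k}. \<theta> i \<omega>) = (\<Pi>\<^sub>M i\<in>{1..k}. distr M borel (\<theta> i))"
    using assms(2,7) by (subst (asm) indep_vars_iff_distr_eq_PiM') auto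
  also have "\<dots> = \<mu>"
    unfolding \<mu>_eq_PiM \<nu>_def by (intro PiM_cong refl distr_\<theta>)
  finally have joint: "distr M (borel \<Otimes>\<^sub>M (\<Pi>\<^sub>M i\<in>{1..k}. borel)) (\<lambda>\<omega>. (Z \<omega>, \<lambda>i\<in>{1..k}. \<theta> i \<omega>)) = \<zeta> \<Otimes>\<^sub>M \<mu>"
    using distr_pair_indep_rvs[OF assms(9)] by (simp add: \<zeta>_def)
  have R_eq: "R \<pi> = (diff_entropy k p0 -
      (\<integral>p. posterior_entropy k f0 \<pi> N (fst p) (snd p) \<partial>(\<zeta> \<Otimes>\<^sub>M \<mu>))) / real N"
    if \<pi>: "\<pi> \<in> policies k N" for \<pi>
  proof -
    \<comment> \<open>\<open>rate\<close> inserts the full function i \<mapsto>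
      \<open>\<theta> i \<omega>\<close>, whereas \<open>\<mu>\<close> lives on functions that are
      undefined outside \<open>{1..k}\<close>. Answers read the coordinates in \<open>{1..k}\<close>
      alone, so restriction leaves the posterior entropy unchanged.\<close>
    have num_in: "num_in k A (\<lambda>i\<in>{1..k}. u i) = num_in k A u" for A u
      by (simp add: num_in_def)
    have ans: "answer k \<pi> z (\<lambda>i\<in>{1..k}. u i) n = answer k \<pi> z u n" for z u n
    proof (induction n rule: less_induct)
      case (less n)
      have "(\<lambda>m\<in>{1..<n}. answer k \<pi> z (\<lambda>i\<in>{1..k}. u i) m) = (\<lambda>m\<in>{1..<n}. answer k \<pi> z u m)"
        by (rule restrict_ext) (rule less.IH, simp)
      then have "question k \<pi> z (\<lambda>i\<in>{1..k}. u i) n = question k \<pi> z u n"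
        by (simp only: question_def)
      then show ?case
        by (simp only: answer_eq_num_in_question num_in)
    qed
    then have ans': "answer k \<pi> z (\<lambda>i\<in>{1..k}. u i) = answer k \<pi> z u" for z u
      by (rule ext)
    have "question k \<pi> z (\<lambda>i\<in>{1..k}. u i) = question k \<pi> z u" for z u
      by (rule ext) (simp only: question_def ans)
    with ans' have pe: "posterior_entropy k f0 \<pi> N z (\<lambda>i\<in>{1..k}. u i) = posterior_entropy k f0 \<pi> N z u" for z u
      by (simp only: posterior_entropy_def)
    have "(borel_measurable (borel \<Otimes>\<^sub>M (\<Pi>\<^sub>M i\<in>{1..k}. borel)) :: (real \<times> (nat \<Rightarrow> real) \<Rightarrow> real) set) =
        borel_measurable (borel \<Otimes>\<^sub>M L)"
      by (rule measurable_cong_sets[OF sets_pair_measure_cong[OF refl sets_PiM_cong]]) simp_all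
    then have "(\<lambda>p. posterior_entropy k f0 \<pi> N (fst p) (snd p)) \<in> borel_measurable (borel \<Otimes>\<^sub>M (\<Pi>\<^sub>M i\<in>{1..k}. borel))"
      using measurable_posterior_entropy[OF \<pi>] by (simp only:)
    then have "(\<integral>p. posterior_entropy k f0 \<pi> N (fst p) (snd p) \<partial>(\<zeta> \<Otimes>\<^sub>M \<mu>)) =
        (\<integral>\<omega>. posterior_entropy k f0 \<pi> N (Z \<omega>) (\<lambda>i\<in>{1..k}. \<theta> i \<omega>) \<partial>M)"
      unfolding joint[symmetric] by (subst integral_distr) simp_all
    then show ?thesis by (simp add: R_def rate_def pe)
  qed
  have upper: "R \<pi> \<le> log 2 (real k + 1)" if "\<pi> \<in> policies k N" for \<pi>
    using entropy_reduction_bounds(1)[OF that \<zeta>] assms(3) R_eq[OF that]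
    by (simp add: divide_le_eq mult.commute)
  note dyadic = dyadic_policy_in_policies[OF assms(4), of k N]
  have "AE z in \<zeta>. real N * (log 2 (real k + 1) / 2) \<le> answer_entropy (dyadic_policy k f0) N z"
    using AE_\<zeta> by eventually_elim (rule answer_entropy_dyadic_ge)
  from entropy_reduction_bounds(2)[OF dyadic \<zeta> this]
  have lower: "R (dyadic_policy k f0) \<ge> log 2 (real k + 1) / 2"
    using assms(3) R_eq[OF dyadic] by (simp add: le_divide_eq mult.commute)
  \<comment> \<open>For k >= 1 this makes the supremum positive.\<close>
  have pos: "log 2 (real k + 1) > 0" using assms(2) by simp
  define S where "S = (SUP \<pi>\<in>policies k N. ereal (R \<pi>))"
  have "S \<le> ereal (log 2 (real k + 1))"
    unfolding S_def by (intro SUP_least) (simp add: upper)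
  moreover have "S \<ge> ereal (R (dyadic_policy k f0))"
    unfolding S_def by (intro SUP_upper dyadic)
  \<comment> \<open>Squeezed between two reals, the supremum is real, and the quotient of extended
    reals becomes an ordinary one.\<close>
  ultimately obtain s where s: "S = ereal s" "s \<le> log 2 (real k + 1)" "R (dyadic_policy k f0) \<le> s"
    by (cases S) auto
  have "s > 0" using s(3) lower pos by linarith
  then have "1 / 2 \<le> R (dyadic_policy k f0) / s"
    using s lower by (simp add: le_divide_eq)
  then have "1 / 2 \<le> ereal (R (dyadic_policy k f0)) / S"
    using \<open>s > 0\<close> by (simp add: s(1) one_ereal_def numeral_eq_ereal)
  then show ?thesis by (simp add: S_def R_def)
qed

end
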